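(* Let $\Omega_1\subset\mathbb{R}^{N_1}$ and $\Omega_2\subset\mathbb{R}^{N_2}$ be regions satisfying (B1) and (B2), and let $\Omega_p:=\Omega_1\times\Omega_2$. Let $\{\lambda_{1j}\}_{j\in\mathbb{N}}$, $\{f_{1j}\}_{j\in\mathbb{N}}$ and $\{\lambda_{2k}\}_{k\in\mathbb{N}}$, $\{f_{2k}\}_{k\in\mathbb{N}}$ be the sequences of Neumann Laplacian eigenvalues and eigenfunctions on $\Omega_1$ and $\Omega_2$ respectively, and put $u_{jk}:=f_{1j}\otimes f_{2k}$, $\mathcal{U}:=\{u_{jk}:j,k\in\mathbb{N}\}$. Then each $u_{jk}\in\mathcal{U}$ is a Neumann Laplacian eigenfunction on $\Omega_p$ corresponding to the eigenvalue $\lambda_{1j}+\lambda_{2k}$. Moreover, $\mathcal{U}$ is orthogonal in $L^2(\Omega_p)$ and also in $H^1(\Omega_p)$ (with its standard inner product).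
   Context: A region is a nonempty, connected, open subset of $\mathbb{R}^N$. All function spaces are real. Condition (B1) on a region $\Omega\subset\mathbb{R}^N$: $\Omega$ is bounded and its boundary $\partial\Omega:=\overline{\Omega}\setminus\Omega$ is the union of a finite number of disjoint closed Lipschitz surfaces, each having finite surface area. Condition (B2): $\Omega$ satisfies (B1); the imbedding of $H^1(\Omega)$ into $L^p(\Omega)$ is compact for $1\le p<p_s$, where $p_s=2N/(N-2)$ if $N\ge3$ and $p_s=\infty$ if $N=2$ (Rellich theorem); and the trace map $\gamma:H^1(\Omega)\to L^2(\partial\Omega,d\sigma)$ is compact, $\sigma$ being $(N-1)$-dimensional Hausdorff measure ($L^2$-compact trace theorem). The standard inner product on $H^1(\Omega)$ is $[u,v]_{1,2}:=\int_\Omega(uv+\nabla u\cdot\nabla v)\,dx$. The Neumann Laplacian eigenproblem on $\Omega$ is to find $(\lambda,u)\in\mathbb{R}\times H^1(\Omega)$ with $u\ne0$ such that $\int_\Omega\nabla u\cdot\nabla h\,dx=\lambda\int_\Omega u\,h\,dx$ for all $h\in H^1(\Omega)$. When $\Omega$ satisfies (B1) and (B2), the Neumann eigendata on $\Omega$ are the increasing sequence $\{\lambda_k:k\in\mathbb{N}\}$ of all Neumann eigenvalues repeated according to multiplicity, $\lambda_k\to\infty$, and associated eigenfunctions $\{f_k:k\in\mathbb{N}\}$ forming a maximal orthonormal set in $H^1(\Omega)$ for $[\cdot,\cdot]_{1,2}$; then $\int_\Omega f_jf_k\,dx=\delta_{jk}/(1+\lambda_k)$ and $\{(1+\lambda_k)^{1/2}f_k\}$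 is a maximal orthonormal set in $L^2(\Omega)$. For functions $f$ on $\Omega_1$ and $g$ on $\Omega_2$, $(f\otimes g)(x,y):=f(x)g(y)$ for $(x,y)\in\Omega_1\times\Omega_2$. *)

theory Defs
  imports "HOL-Analysis.Analysis"
begin

(* Functions on a region are represented by total functions of which only the values on the
   region matter; elements of Lp and H1 are representatives, so "equal" and "zero" mean
   almost everywhere on the region. *)

definition region :: "'a::euclidean_space set \<Rightarrow> bool" where
  "region \<Omega> \<longleftrightarrow> \<Omega> \<noteq> {} \<and> connected \<Omega> \<and> open \<Omega>"


section \<open>Lebesgue spaces\<close>

definition Lp :: "'a measure \<Rightarrow> real \<Rightarrow> ('a \<Rightarrow> 'b::euclidean_space) set" where
  "Lp M p = {f \<in> borel_measurable M. integrable M (\<lambda>x. norm (f x) powr p)}"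

definition Lp_norm :: "'a measure \<Rightarrow> real \<Rightarrow> ('a \<Rightarrow> 'b::euclidean_space) \<Rightarrow> real" where
  "Lp_norm M p f = (\<integral>x. norm (f x) powr p \<partial>M) powr (1 / p)"

definition L2_inner :: "'a::euclidean_space set \<Rightarrow> ('a \<Rightarrow> real) \<Rightarrow> ('a \<Rightarrow> real) \<Rightarrow> real" where
  "L2_inner \<Omega> u v = (\<integral>x. u x * v x \<partial>(lebesgue_on \<Omega>))"


section \<open>The Sobolev space \<open>H\<^sup>1\<close>\<close>

primrec C_k :: "nat \<Rightarrow> ('a::euclidean_space \<Rightarrow> real) \<Rightarrow> bool" where
  "C_k 0 \<phi> \<longleftrightarrow> continuous_on UNIV \<phi>"
| "C_k (Suc k) \<phi> \<longleftrightarrow> \<phi> differentiable_on UNIV \<and>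
     (\<forall>b\<in>Basis. C_k k (\<lambda>x. frechet_derivative \<phi> (at x) b))"

definition test_function :: "'a::euclidean_space set \<Rightarrow> ('a \<Rightarrow> real) \<Rightarrow> bool" where
  "test_function \<Omega> \<phi> \<longleftrightarrow> (\<forall>k. C_k k \<phi>) \<and> (\<exists>K. compact K \<and> K \<subseteq> \<Omega> \<and> (\<forall>x. x \<notin> K \<longrightarrow> \<phi> x = 0))"

definition is_weak_gradient ::
    "'a::euclidean_space set \<Rightarrow> ('a \<Rightarrow> real) \<Rightarrow> ('a \<Rightarrow> 'a) \<Rightarrow> bool" where
  "is_weak_gradient \<Omega> u G \<longleftrightarrow>
     (\<forall>\<phi>. test_function \<Omega> \<phi> \<longrightarrow> (\<forall>b\<in>Basis.
        (\<integral>x. u x * frechet_derivative \<phi> (at x) b \<partial>(lebesgue_on \<Omega>))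
          = - (\<integral>x. (G x \<bullet> b) * \<phi> x \<partial>(lebesgue_on \<Omega>))))"

definition H1 :: "'a::euclidean_space set \<Rightarrow> ('a \<Rightarrow> real) set" where
  "H1 \<Omega> = {u \<in> Lp (lebesgue_on \<Omega>) 2. \<exists>G \<in> Lp (lebesgue_on \<Omega>) 2. is_weak_gradient \<Omega> u G}"

(* The weak gradient is unique up to null sets, so the choice is immaterial under integrals. *)
definition wgrad :: "'a::euclidean_space set \<Rightarrow> ('a \<Rightarrow> real) \<Rightarrow> 'a \<Rightarrow> 'a" where
  "wgrad \<Omega> u = (SOME G. G \<in> Lp (lebesgue_on \<Omega>) 2 \<and> is_weak_gradient \<Omega> u G)"

definition H1_inner :: "'a::euclidean_space set \<Rightarrow> ('a \<Rightarrow> real) \<Rightarrow> ('a \<Rightarrow> real) \<Rightarrow> real" where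
  "H1_inner \<Omega> u v = (\<integral>x. u x * v x + wgrad \<Omega> u x \<bullet> wgrad \<Omega> v x \<partial>(lebesgue_on \<Omega>))"

definition H1_norm :: "'a::euclidean_space set \<Rightarrow> ('a \<Rightarrow> real) \<Rightarrow> real" where
  "H1_norm \<Omega> u = sqrt (H1_inner \<Omega> u u)"


section \<open>Hausdorff measure\<close>

(* Normalised so that the d-dimensional measure on a d-dimensional space is Lebesgue measure.
   The exponent is a nat, so that (diameter C / 2) ^ 0 = 1 for a singleton C, as needed for
   counting measure at d = 0.  Boundedness is explicit since diameter is a real supremum. *)
definition hausdorff_pre :: "nat \<Rightarrow> real \<Rightarrow> 'a::euclidean_space set \<Rightarrow> ennreal" where
  "hausdorff_pre d \<delta> A =
     (INF C \<in> {C :: nat \<Rightarrow> 'a set. A \<subseteq> (\<Union>i. C i) \<and> (\<forall>i. bounded (C i) \<and> diameter (C i) \<le> \<delta>)}.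
        \<Sum>i. if C i = {} then 0 else ennreal (unit_ball_vol (real d) * (diameter (C i) / 2) ^ d))"

definition hausdorff_outer :: "nat \<Rightarrow> 'a::euclidean_space set \<Rightarrow> ennreal" where
  "hausdorff_outer d A = (SUP \<delta>\<in>{0<..}. hausdorff_pre d \<delta> A)"

(* hausdorff_outer is a metric outer measure, hence countably additive on Borel sets
   (Caratheodory), so measure_of does not collapse to the zero measure. *)
definition hausdorff_measure :: "nat \<Rightarrow> 'a::euclidean_space measure" where
  "hausdorff_measure d = measure_of UNIV (sets borel) (hausdorff_outer d)"


section \<open>Conditions on the region\<close>

definition bdry :: "'a::euclidean_space set \<Rightarrow> 'a set" where
  "bdry \<Omega> = closure \<Omega> - \<Omega>"

definition surface_measure :: "'a::euclidean_space set \<Rightarrow> 'a measure" where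
  "surface_measure \<Omega> = restrict_space (hausdorff_measure (DIM('a) - 1)) (bdry \<Omega>)"

(* Compact, and near each of its points the graph, in some direction e, of a Lipschitz function
   on the hyperplane orthogonal to e. *)
definition closed_lipschitz_surface :: "'a::euclidean_space set \<Rightarrow> bool" where
  "closed_lipschitz_surface S \<longleftrightarrow> compact S \<and>
     (\<forall>x\<in>S. \<exists>r>0. \<exists>e g L. norm e = 1 \<and> L-lipschitz_on {z. z \<bullet> e = 0} (g :: 'a \<Rightarrow> real) \<and>
        S \<inter> ball x r = {y \<in> ball x r. y \<bullet> e = g (y - (y \<bullet> e) *\<^sub>R e)})"

definition cond_B1 :: "'a::euclidean_space set \<Rightarrow> bool" where
  "cond_B1 \<Omega> \<longleftrightarrow> bounded \<Omega> \<and>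
     (\<exists>\<S>. finite \<S> \<and> pairwise disjnt \<S> \<and> bdry \<Omega> = \<Union>\<S> \<and>
        (\<forall>S\<in>\<S>. closed_lipschitz_surface S \<and> emeasure (hausdorff_measure (DIM('a) - 1)) S < \<infinity>))"

(* For N = 1, where the formula has no meaning, the exponent is infinite as for N = 2. *)
definition sobolev_exponent :: "nat \<Rightarrow> ereal" where
  "sobolev_exponent N = (if N \<ge> 3 then ereal (2 * real N / (real N - 2)) else \<infinity>)"

(* Compactness of a linear map T from (V, nV) to (W, nW): images of bounded sequences have
   convergent subsequences. *)
definition compact_map ::
    "('a \<Rightarrow> real) set \<Rightarrow> (('a \<Rightarrow> real) \<Rightarrow> real) \<Rightarrow> ('b \<Rightarrow> real) set \<Rightarrow> (('b \<Rightarrow> real) \<Rightarrow> real)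
      \<Rightarrow> (('a \<Rightarrow> real) \<Rightarrow> ('b \<Rightarrow> real)) \<Rightarrow> bool" where
  "compact_map V nV W nW T \<longleftrightarrow> (\<forall>u\<in>V. T u \<in> W) \<and>
     (\<forall>u :: nat \<Rightarrow> 'a \<Rightarrow> real. (\<forall>n. u n \<in> V) \<and> (\<exists>B. \<forall>n. nV (u n) \<le> B) \<longrightarrow>
        (\<exists>r v. strict_mono (r :: nat \<Rightarrow> nat) \<and> v \<in> W \<and>
           (\<lambda>n. nW (\<lambda>x. T (u (r n)) x - v x)) \<longlonglongrightarrow> 0))"

(* The trace map is the continuous linear extension to H1 of the map restricting functions that
   are Lipschitz on the closure of the region to its boundary. *)
definition is_trace_map ::
    "'a::euclidean_space set \<Rightarrow> (('a \<Rightarrow> real) \<Rightarrow> ('a \<Rightarrow> real)) \<Rightarrow> bool" where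
  "is_trace_map \<Omega> T \<longleftrightarrow>
     (\<forall>u\<in>H1 \<Omega>. T u \<in> Lp (surface_measure \<Omega>) 2) \<and>
     (\<forall>u\<in>H1 \<Omega>. \<forall>v\<in>H1 \<Omega>. \<forall>a b. AE x in surface_measure \<Omega>.
        T (\<lambda>y. a * u y + b * v y) x = a * T u x + b * T v x) \<and>
     (\<exists>C. \<forall>u\<in>H1 \<Omega>. Lp_norm (surface_measure \<Omega>) 2 (T u) \<le> C * H1_norm \<Omega> u) \<and>
     (\<forall>u\<in>H1 \<Omega>. (\<exists>L. L-lipschitz_on (closure \<Omega>) u) \<longrightarrow>
        (AE x in surface_measure \<Omega>. T u x = u x))"

definition cond_B2 :: "'a::euclidean_space set \<Rightarrow> bool" where
  "cond_B2 \<Omega> \<longleftrightarrow> cond_B1 \<Omega> \<and>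
     (\<forall>p. 1 \<le> p \<and> ereal p < sobolev_exponent DIM('a) \<longrightarrow>
        compact_map (H1 \<Omega>) (H1_norm \<Omega>)
          (Lp (lebesgue_on \<Omega>) p) (Lp_norm (lebesgue_on \<Omega>) p) (\<lambda>u. u)) \<and>
     (\<exists>T. is_trace_map \<Omega> T \<and>
        compact_map (H1 \<Omega>) (H1_norm \<Omega>)
          (Lp (surface_measure \<Omega>) 2) (Lp_norm (surface_measure \<Omega>) 2) T)"


section \<open>The Neumann eigenproblem\<close>

definition neumann_eigenspace :: "'a::euclidean_space set \<Rightarrow> real \<Rightarrow> ('a \<Rightarrow> real) set" where
  "neumann_eigenspace \<Omega> \<mu> = {u \<in> H1 \<Omega>. \<forall>h\<in>H1 \<Omega>.
     (\<integral>x. wgrad \<Omega> u x \<bullet> wgrad \<Omega> h x \<partial>(lebesgue_on \<Omega>))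
       = \<mu> * (\<integral>x. u x * h x \<partial>(lebesgue_on \<Omega>))}"

definition neumann_eigenpair :: "'a::euclidean_space set \<Rightarrow> real \<Rightarrow> ('a \<Rightarrow> real) \<Rightarrow> bool" where
  "neumann_eigenpair \<Omega> \<mu> u \<longleftrightarrow>
     u \<in> neumann_eigenspace \<Omega> \<mu> \<and> \<not> (AE x in lebesgue_on \<Omega>. u x = 0)"

(* Dimension of the eigenspace modulo null functions; 0 if \<mu> is not an eigenvalue. *)
definition neumann_multiplicity :: "'a::euclidean_space set \<Rightarrow> real \<Rightarrow> enat" where
  "neumann_multiplicity \<Omega> \<mu> =
     (SUP n \<in> {n. \<exists>g :: nat \<Rightarrow> 'a \<Rightarrow> real. (\<forall>i<n. g i \<in> neumann_eigenspace \<Omega> \<mu>) \<and>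
          (\<forall>c. (AE x in lebesgue_on \<Omega>. (\<Sum>i<n. c i * g i x) = 0) \<longrightarrow> (\<forall>i<n. c i = (0::real)))}.
        enat n)"

definition neumann_eigendata ::
    "'a::euclidean_space set \<Rightarrow> (nat \<Rightarrow> real) \<Rightarrow> (nat \<Rightarrow> 'a \<Rightarrow> real) \<Rightarrow> bool" where
  "neumann_eigendata \<Omega> lam f \<longleftrightarrow>
     mono lam \<and> filterlim lam at_top sequentially \<and>
     (\<forall>\<mu>. finite {k. lam k = \<mu>} \<and> enat (card {k. lam k = \<mu>}) = neumann_multiplicity \<Omega> \<mu>) \<and>
     (\<forall>k. neumann_eigenpair \<Omega> (lam k) (f k)) \<and>
     (\<forall>j k. H1_inner \<Omega> (f j) (f k) = (if j = k then 1 else 0)) \<and>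
     (\<forall>u\<in>H1 \<Omega>. (\<forall>k. H1_inner \<Omega> u (f k) = 0) \<longrightarrow> (AE x in lebesgue_on \<Omega>. u x = 0))"


definition tensor :: "('a \<Rightarrow> real) \<Rightarrow> ('b \<Rightarrow> real) \<Rightarrow> 'a \<times> 'b \<Rightarrow> real" where
  "tensor f g = (\<lambda>(x, y). f x * g y)"

end

theory Submission
  imports Defs
begin

text \<open>
  Write \<open>f\<close>, \<open>g\<close> for eigenfunctions on the factors with eigenvalues \<open>\<mu>\<close>, \<open>\<nu>\<close> and weak gradients \<open>F\<close>, \<open>G\<close>.
  By Fubini's theorem and integration by parts in one variable at a time, the tensor product
  \<open>u(x, y) = f(x) g(y)\<close> has the weak gradient \<open>(g(y) F(x), f(x) G(y))\<close>.  For \<open>h\<close> in \<open>H\<^sup>1\<close> of the product, with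
  weak gradient \<open>(D\<^sub>x, D\<^sub>y)\<close>, the Dirichlet form of \<open>u\<close> and \<open>h\<close> is therefore the sum of
  \<open>\<integral> g(y) F(x) \<bullet> D\<^sub>x(x, y)\<close> and \<open>\<integral> f(x) G(y) \<bullet> D\<^sub>y(x, y)\<close>.  By symmetry it is enough to treat the first.

  It would be natural to use that almost every slice \<open>h(\<cdot>, y)\<close> lies in \<open>H\<^sup>1\<close> of the first factor, but then one null
  set of \<open>y\<close> would have to serve all test functions.  Instead \<open>y\<close> is integrated out first: the average
  \<open>H(x) = \<integral> g(y) h(x, y) dy\<close> lies in \<open>H\<^sup>1\<close> of the first factor and has the weak gradient
  \<open>\<integral> g(y) D\<^sub>x(x, y) dy\<close> (\<open>weak_partial_partial_integral\<close>).  Testing the eigenvalue equation of \<open>f\<close> with \<open>H\<close> gives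
  \<open>\<mu> \<integral> f(x) g(y) h(x, y)\<close>, so the whole form is \<open>(\<mu> + \<nu>) \<integral> u h\<close> (\<open>tensor_eigenspace\<close>).

  Weak gradients are determined only up to null sets, and \<open>wgrad\<close> chooses one of them; passing between the
  chosen and the computed gradient needs the fundamental lemma of the calculus of variations
  (\<open>AE_eq_0_if_orthogonal_test_functions\<close>).

  Orthogonality is algebra.  An eigenfunction \<open>u\<close> for \<open>\<mu>\<close> satisfies \<open>[u, h]\<^sub>1\<^sub>,\<^sub>2 = (1 + \<mu>) \<integral> u h\<close>, so orthonormality in \<open>H\<^sup>1\<close>
  forces \<open>1 + \<mu> \<noteq> 0\<close> and orthogonality in \<open>L\<^sup>2\<close> on each factor, with nonzero norms.  The \<open>L\<^sup>2\<close> product of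
  tensor products is the product of the \<open>L\<^sup>2\<close> products, which gives orthogonality in \<open>L\<^sup>2\<close> on the product domain
  and shows that no tensor product vanishes; the same identity on the product domain gives orthogonality in \<open>H\<^sup>1\<close>.
\<close>

section \<open>Lebesgue measure on products\<close>

lemma borel_measurable_lebesgue_cong_AE:
  fixes f g :: "'a::euclidean_space \<Rightarrow> real"
  assumes "f \<in> borel_measurable lebesgue" "AE x in lebesgue. f x = g x"
  shows "g \<in> borel_measurable lebesgue"
proof (rule measurableI)
  fix A :: "real set" assume "A \<in> sets borel"
  then have m: "f -` A \<inter> space lebesgue \<in> sets lebesgue"
    using assms(1) by (rule measurable_sets[rotated])
  have ae: "AE x in lebesgue. x \<in> f -` A \<inter> space lebesgue \<longleftrightarrow> x \<in> g -` A \<inter> space lebesgue"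
    using assms(2) by eventually_elim simp
  show "g -` A \<inter> space lebesgue \<in> sets lebesgue"
    by (rule completion.in_sets_AE[OF ae m]) simp
qed simp

text \<open>
  Lebesgue measure on the product space is the completion of a product measure, not a product measure itself, so
  the product theorems of measure theory reach a Lebesgue measurable \<open>K\<close> only through a Borel function equal to
  it almost everywhere.  The iterated form of the exceptional set is what Fubini arguments use.
\<close>

lemma lebesgue_prod_borel_representative:
  fixes K :: "'a::euclidean_space \<times> 'b::euclidean_space \<Rightarrow> real"
  assumes "K \<in> borel_measurable lebesgue"
  obtains K' where "K' \<in> borel_measurable borel" "AE z in lebesgue. K z = K' z"
    "AE x in lebesgue. AE y in lebesgue. K (x, y) = K' (x, y)"
proof -
  obtain K' where K': "K' \<in> borel_measurable lborel" "AE z in lborel. K z = K' z"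
    using completion_ex_borel_measurable_real[OF assms] by blast
  have "AE z in (lborel :: 'a measure) \<Otimes>\<^sub>M (lborel :: 'b measure). K z = K' z"
    using K'(2) unfolding lborel_prod .
  then have "AE x in lborel. AE y in lborel. K (x, y) = K' (x, y)"
    by (rule lborel_pair.AE_pair)
  then show ?thesis
    using K' by (intro that[of K']) (simp_all add: AE_completion_iff)
qed

lemma borel_measurable_imp_lebesgue:
  "f \<in> borel_measurable borel \<Longrightarrow> f \<in> borel_measurable lebesgue"
  by (rule measurable_completion) simp

lemma borel_measurable_slice:
  fixes K :: "'a::euclidean_space \<times> 'b::euclidean_space \<Rightarrow> real"
  assumes "K \<in> borel_measurable borel"
  shows "(\<lambda>y. K (x, y)) \<in> borel_measurable borel"
proof (rule measurable_compose[OF _ assms])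
  show "Pair x \<in> borel_measurable borel"
    by (intro borel_measurable_continuous_onI continuous_intros)
qed

text \<open>
  The exceptional set is genuine: a null set of the product may have a nonmeasurable slice.
\<close>

lemma AE_borel_measurable_slice:
  fixes K :: "'a::euclidean_space \<times> 'b::euclidean_space \<Rightarrow> real"
  assumes "K \<in> borel_measurable lebesgue"
  shows "AE x in lebesgue. (\<lambda>y. K (x, y)) \<in> borel_measurable lebesgue"
proof -
  obtain K' where K': "K' \<in> borel_measurable borel" "AE z in lebesgue. K z = K' z"
    "AE x in lebesgue. AE y in lebesgue. K (x, y) = K' (x, y)"
    by (rule lebesgue_prod_borel_representative[OF assms])
  from K'(3) show ?thesis
  proof eventually_elim
    case (elim x)
    have "(\<lambda>y. K' (x, y)) \<in> borel_measurable borel"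
      by (rule borel_measurable_slice[OF K'(1)])
    then have "(\<lambda>y. K' (x, y)) \<in> borel_measurable lebesgue"
      by (rule borel_measurable_imp_lebesgue)
    then show ?case
      by (rule borel_measurable_lebesgue_cong_AE) (rule AE_mp[OF elim], simp)
  qed
qed

lemma integral_lebesgue_eq_borel:
  fixes f g :: "'a::euclidean_space \<Rightarrow> real"
  assumes g: "g \<in> borel_measurable borel" and eq: "AE x in lebesgue. f x = g x"
  shows "integrable lebesgue f \<longleftrightarrow> integrable lborel g" "integral\<^sup>L lebesgue f = integral\<^sup>L lborel g"
proof -
  have gl: "g \<in> borel_measurable lebesgue"
    using g by (rule borel_measurable_imp_lebesgue)
  have fl: "f \<in> borel_measurable lebesgue"
    by (rule borel_measurable_lebesgue_cong_AE[OF gl]) (rule AE_mp[OF eq], simp)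
  show "integrable lebesgue f \<longleftrightarrow> integrable lborel g"
    using integrable_cong_AE[OF fl gl eq] g by (simp add: integrable_completion)
  show "integral\<^sup>L lebesgue f = integral\<^sup>L lborel g"
    using integral_cong_AE[OF fl gl eq] g by (simp add: integral_completion)
qed

lemma borel_measurable_partial_integral_UNIV:
  fixes K :: "'a::euclidean_space \<times> 'b::euclidean_space \<Rightarrow> real"
  assumes "K \<in> borel_measurable lebesgue"
  shows "(\<lambda>x. \<integral>y. K (x, y) \<partial>lebesgue) \<in> borel_measurable lebesgue"
proof -
  obtain K' where K': "K' \<in> borel_measurable borel" "AE z in lebesgue. K z = K' z"
    "AE x in lebesgue. AE y in lebesgue. K (x, y) = K' (x, y)"
    by (rule lebesgue_prod_borel_representative[OF assms])
  have "K' \<in> borel_measurable (lborel \<Otimes>\<^sub>M lborel)"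
    using K'(1) unfolding lborel_prod by simp
  then have "(\<lambda>x. \<integral>y. K' (x, y) \<partial>lborel) \<in> borel_measurable lborel"
    by (intro lborel.borel_measurable_lebesgue_integral) simp
  then have "(\<lambda>x. \<integral>y. K' (x, y) \<partial>lborel) \<in> borel_measurable lebesgue"
    by (rule measurable_completion)
  moreover have "AE x in lebesgue. (\<integral>y. K' (x, y) \<partial>lborel) = (\<integral>y. K (x, y) \<partial>lebesgue)"
    using K'(3)
  proof eventually_elim
    case (elim x)
    have "(\<lambda>y. K' (x, y)) \<in> borel_measurable borel"
      by (rule borel_measurable_slice[OF K'(1)])
    from integral_lebesgue_eq_borel(2)[OF this elim] show ?case by simp
  qed
  ultimately show ?thesis by (rule borel_measurable_lebesgue_cong_AE)
qed

lemma Fubini_lebesgue_UNIV: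
  fixes K :: "'a::euclidean_space \<times> 'b::euclidean_space \<Rightarrow> real"
  assumes K: "integrable lebesgue K"
  shows "AE x in lebesgue. integrable lebesgue (\<lambda>y. K (x, y))"
    and "integrable lebesgue (\<lambda>x. \<integral>y. K (x, y) \<partial>lebesgue)"
    and "(\<integral>x. \<integral>y. K (x, y) \<partial>lebesgue \<partial>lebesgue) = integral\<^sup>L lebesgue K"
proof -
  have Km: "K \<in> borel_measurable lebesgue" using K by simp
  obtain K' where K': "K' \<in> borel_measurable borel" "AE z in lebesgue. K z = K' z"
    "AE x in lebesgue. AE y in lebesgue. K (x, y) = K' (x, y)"
    by (rule lebesgue_prod_borel_representative[OF Km])
  have slice: "(\<lambda>y. K' (x, y)) \<in> borel_measurable borel" for x
    by (rule borel_measurable_slice[OF K'(1)])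
  have int: "integrable (lborel \<Otimes>\<^sub>M lborel) K'"
    using K integral_lebesgue_eq_borel(1)[OF K'(1,2)] unfolding lborel_prod by blast
  have "AE x in lebesgue. integrable lborel (\<lambda>y. K' (x, y))"
    using lborel_pair.AE_integrable_fst'[OF int] by (simp add: AE_completion_iff)
  with K'(3) show "AE x in lebesgue. integrable lebesgue (\<lambda>y. K (x, y))"
    by eventually_elim (simp add: integral_lebesgue_eq_borel(1)[OF slice])
  have i: "integrable lborel (\<lambda>x. \<integral>y. K' (x, y) \<partial>lborel)"
    by (rule lborel_pair.integrable_fst'[OF int])
  then have im: "(\<lambda>x. \<integral>y. K' (x, y) \<partial>lborel) \<in> borel_measurable borel"
    using borel_measurable_integrable[OF i] by simp
  have eq: "AE x in lebesgue. (\<integral>y. K (x, y) \<partial>lebesgue) = (\<integral>y. K' (x, y) \<partial>lborel)"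
    using K'(3) by eventually_elim (rule integral_lebesgue_eq_borel(2)[OF slice])
  show "integrable lebesgue (\<lambda>x. \<integral>y. K (x, y) \<partial>lebesgue)"
    using i integral_lebesgue_eq_borel(1)[OF im eq] by simp
  show "(\<integral>x. \<integral>y. K (x, y) \<partial>lebesgue \<partial>lebesgue) = integral\<^sup>L lebesgue K"
    unfolding integral_lebesgue_eq_borel(2)[OF im eq] integral_lebesgue_eq_borel(2)[OF K'(1,2)]
    using lborel_pair.integral_fst'[OF int] by (simp add: lborel_prod)
qed

lemma lborel_distr_swap:
  "distr lborel lborel prod.swap = (lborel :: ('b::euclidean_space \<times> 'a::euclidean_space) measure)"
proof -
  have "(lborel :: ('b \<times> 'a) measure) = lborel \<Otimes>\<^sub>M lborel" by (simp add: lborel_prod)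
  also have "\<dots> = distr (lborel \<Otimes>\<^sub>M lborel :: ('a \<times> 'b) measure) (lborel \<Otimes>\<^sub>M lborel) (\<lambda>(x, y). (y, x))"
    by (rule lborel_pair.distr_pair_swap)
  finally show ?thesis
    by (simp add: lborel_prod prod.swap_def[abs_def] case_prod_beta')
qed

lemma swap_measurable_lborel:
  "(prod.swap :: 'a::euclidean_space \<times> 'b::euclidean_space \<Rightarrow> _) \<in> lborel \<rightarrow>\<^sub>M lborel"
  by (simp add: measurable_lborel1 measurable_lborel2) (intro borel_measurable_continuous_onI continuous_on_swap)

text \<open>
  Exchanging the factors preserves Lebesgue measure, and with it every statement about one factor carries over
  to the other.
\<close>

lemma lebesgue_distr_swap:
  "distr lebesgue lebesgue prod.swap = (lebesgue :: ('b::euclidean_space \<times> 'a::euclidean_space) measure)"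
proof -
  have e: "distr lebesgue lborel prod.swap = (lborel :: ('b \<times> 'a) measure)"
    by (simp add: distr_completion[OF swap_measurable_lborel] lborel_distr_swap)
  have "completion (distr lebesgue lborel prod.swap)
      = distr lebesgue (lebesgue :: ('b \<times> 'a) measure) prod.swap"
    by (rule completion.completion_distr_eq[OF measurable_completion[OF swap_measurable_lborel]])
      (simp only: e)
  then show ?thesis by (simp add: e)
qed

lemma swap_measurable_lebesgue:
  "(prod.swap :: 'a::euclidean_space \<times> 'b::euclidean_space \<Rightarrow> _) \<in> lebesgue \<rightarrow>\<^sub>M lebesgue"
proof (rule completion.measurable_completion2[OF measurable_completion[OF swap_measurable_lborel]])
  have "distr lebesgue lborel prod.swap = (lborel :: ('b \<times> 'a) measure)"
    by (simp add: distr_completion[OF swap_measurable_lborel] lborel_distr_swap)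
  then show "null_sets lborel \<subseteq> null_sets (distr lebesgue (lborel :: ('b \<times> 'a) measure) prod.swap)"
    by simp
qed

text \<open>
  Measurability between the completed sigma-algebras asks in addition that preimages of null sets be null; here the
  preimage of \<open>N\<close> is \<open>N \<times> UNIV\<close>.
\<close>

lemma fst_measurable_lebesgue:
  "(fst :: 'a::euclidean_space \<times> 'b::euclidean_space \<Rightarrow> 'a) \<in> lebesgue \<rightarrow>\<^sub>M lebesgue"
proof -
  have m: "(fst :: 'a \<times> 'b \<Rightarrow> 'a) \<in> lborel \<rightarrow>\<^sub>M lborel"
    by simp (intro borel_measurable_continuous_onI continuous_intros)
  show ?thesis
  proof (rule completion.measurable_completion2[OF measurable_completion[OF m]], rule subsetI)
    fix N :: "'a set" assume N: "N \<in> null_sets lborel"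
    then have "emeasure (lborel \<Otimes>\<^sub>M lborel) (N \<times> (UNIV :: 'b set)) = 0"
      by (subst lborel.emeasure_pair_measure_Times) (auto simp: null_sets_def)
    moreover have "fst -` N = N \<times> (UNIV :: 'b set)" by auto
    ultimately show "N \<in> null_sets (distr (lebesgue :: ('a \<times> 'b) measure) lborel fst)"
      using N by (simp add: null_sets_def distr_completion[OF m] emeasure_distr[OF m] lborel_prod)
  qed
qed

lemma snd_measurable_lebesgue:
  "(snd :: 'a::euclidean_space \<times> 'b::euclidean_space \<Rightarrow> 'b) \<in> lebesgue \<rightarrow>\<^sub>M lebesgue"
proof -
  have "(snd :: 'a \<times> 'b \<Rightarrow> 'b) = fst \<circ> prod.swap" by auto
  then show ?thesis
    using measurable_comp[OF swap_measurable_lebesgue fst_measurable_lebesgue] by metis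
qed

text \<open>
  Tonelli's criterion, transported from the Borel representative to \<open>K\<close>.
\<close>

lemma Fubini_integrable_lebesgue_UNIV:
  fixes K :: "'a::euclidean_space \<times> 'b::euclidean_space \<Rightarrow> real"
  assumes K: "K \<in> borel_measurable lebesgue"
    and slice: "AE x in lebesgue. integrable lebesgue (\<lambda>y. K (x, y))"
    and int: "integrable lebesgue (\<lambda>x. \<integral>y. \<bar>K (x, y)\<bar> \<partial>lebesgue)"
  shows "integrable lebesgue K"
proof -
  obtain K' where K': "K' \<in> borel_measurable borel" "AE z in lebesgue. K z = K' z"
    "AE x in lebesgue. AE y in lebesgue. K (x, y) = K' (x, y)"
    by (rule lebesgue_prod_borel_representative[OF K])
  have m: "(\<lambda>y. K' (x, y)) \<in> borel_measurable borel" "(\<lambda>y. \<bar>K' (x, y)\<bar>) \<in> borel_measurable borel" for x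
    using borel_measurable_slice[OF K'(1), of x] by simp_all
  have K'': "K' \<in> borel_measurable (lborel \<Otimes>\<^sub>M lborel)"
    using K'(1) unfolding lborel_prod by simp
  have "integrable (lborel \<Otimes>\<^sub>M lborel) K'"
  proof (rule lborel_pair.Fubini_integrable[OF K''])
    have "(\<lambda>z. \<bar>K' z\<bar>) \<in> borel_measurable (lborel \<Otimes>\<^sub>M lborel)"
      using K'(1) unfolding lborel_prod by simp
    then have mi: "(\<lambda>x. \<integral>y. \<bar>K' (x, y)\<bar> \<partial>lborel) \<in> borel_measurable borel"
      using lborel.borel_measurable_lebesgue_integral[of "\<lambda>x y. \<bar>K' (x, y)\<bar>" lborel] by simp
    have "AE x in lebesgue. (\<integral>y. \<bar>K (x, y)\<bar> \<partial>lebesgue) = (\<integral>y. \<bar>K' (x, y)\<bar> \<partial>lborel)"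
      using K'(3)
    proof eventually_elim
      case (elim x)
      show ?case
        by (rule integral_lebesgue_eq_borel(2)[OF m(2)]) (use elim in eventually_elim, simp)
    qed
    from integral_lebesgue_eq_borel(1)[OF mi this] int
    show "integrable lborel (\<lambda>x. \<integral>y. norm (K' (x, y)) \<partial>lborel)" by simp
    have "AE x in lebesgue. integrable lborel (\<lambda>y. K' (x, y))"
      using slice K'(3) by eventually_elim (simp add: integral_lebesgue_eq_borel(1)[OF m(1)])
    then show "AE x in lborel. integrable lborel (\<lambda>y. K' (x, y))"
      by (simp add: AE_completion_iff)
  qed
  then show ?thesis
    using integral_lebesgue_eq_borel(1)[OF K'(1,2)] unfolding lborel_prod by blast
qed

lemma fst_measurable_lebesgue_on:
  "fst \<in> lebesgue_on (A \<times> B) \<rightarrow>\<^sub>M lebesgue_on (A :: 'a::euclidean_space set)"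
  for B :: "'b::euclidean_space set"
  by (rule measurable_restrict_space3[OF fst_measurable_lebesgue]) auto

lemma snd_measurable_lebesgue_on:
  "snd \<in> lebesgue_on (A \<times> B) \<rightarrow>\<^sub>M lebesgue_on (B :: 'b::euclidean_space set)"
  for A :: "'a::euclidean_space set"
  by (rule measurable_restrict_space3[OF snd_measurable_lebesgue]) auto

lemma lebesgue_sets_Times:
  fixes A :: "'a::euclidean_space set" and B :: "'b::euclidean_space set"
  assumes "A \<in> sets lebesgue" "B \<in> sets lebesgue"
  shows "A \<times> B \<in> sets lebesgue"
proof -
  have "A \<times> B = (fst -` A \<inter> space lebesgue) \<inter> (snd -` B \<inter> space lebesgue)" by auto
  also have "\<dots> \<in> sets lebesgue"
    using assms fst_measurable_lebesgue snd_measurable_lebesgue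
    by (intro sets.Int measurable_sets)
  finally show ?thesis .
qed

lemma swap_measurable_lebesgue_on:
  fixes A :: "'a::euclidean_space set" and B :: "'b::euclidean_space set"
  shows "prod.swap \<in> lebesgue_on (A \<times> B) \<rightarrow>\<^sub>M lebesgue_on (B \<times> A)"
  by (rule measurable_restrict_space3[OF swap_measurable_lebesgue]) auto

text \<open>
  The two factors carry the whole setting: every statement proved for \<open>A \<times> B\<close> is available for \<open>B \<times> A\<close> by a second
  interpretation, and the two are related by \<open>prod.swap\<close>.
\<close>

locale lebesgue_product =
  fixes A :: "'a::euclidean_space set" and B :: "'b::euclidean_space set"
  assumes A: "A \<in> sets lebesgue" and B: "B \<in> sets lebesgue"
begin

lemma Times_sets_lebesgue: "A \<times> B \<in> sets lebesgue"
  using A B by (rule lebesgue_sets_Times)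

lemma integral_swap:
  fixes K :: "'a \<times> 'b \<Rightarrow> real"
  assumes "K \<in> borel_measurable (lebesgue_on (A \<times> B))"
  shows "integrable (lebesgue_on (B \<times> A)) (\<lambda>z. K (prod.swap z)) \<longleftrightarrow> integrable (lebesgue_on (A \<times> B)) K"
    and "(\<integral>z. K (prod.swap z) \<partial>lebesgue_on (B \<times> A)) = integral\<^sup>L (lebesgue_on (A \<times> B)) K"
proof -
  let ?K = "\<lambda>z. indicator (A \<times> B) z *\<^sub>R K z"
  have K: "?K \<in> borel_measurable lebesgue"
    using assms Times_sets_lebesgue by (simp add: borel_measurable_restrict_space_iff)
  have i: "indicator (B \<times> A) z *\<^sub>R K (prod.swap z) = ?K (prod.swap z)" for z
    by (cases z) (auto simp: indicator_def)
  have BA: "B \<times> A \<in> sets lebesgue" using A B lebesgue_sets_Times by blast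
  show "integrable (lebesgue_on (B \<times> A)) (\<lambda>z. K (prod.swap z)) \<longleftrightarrow> integrable (lebesgue_on (A \<times> B)) K"
    using Times_sets_lebesgue BA integrable_distr_eq[OF swap_measurable_lebesgue K]
    by (simp add: integrable_restrict_space i lebesgue_distr_swap del: real_scaleR_def)
  show "(\<integral>z. K (prod.swap z) \<partial>lebesgue_on (B \<times> A)) = integral\<^sup>L (lebesgue_on (A \<times> B)) K"
    using Times_sets_lebesgue BA integral_distr[OF swap_measurable_lebesgue K]
    by (simp add: integral_restrict_space i lebesgue_distr_swap del: real_scaleR_def)
qed

lemma borel_measurable_partial_integral:
  fixes K :: "'a \<times> 'b \<Rightarrow> real"
  assumes "K \<in> borel_measurable (lebesgue_on (A \<times> B))"
  shows "(\<lambda>x. \<integral>y. K (x, y) \<partial>lebesgue_on B) \<in> borel_measurable (lebesgue_on A)"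
    and "AE x in lebesgue_on A. (\<lambda>y. K (x, y)) \<in> borel_measurable (lebesgue_on B)"
proof -
  let ?K = "\<lambda>z. indicator (A \<times> B) z *\<^sub>R K z"
  have K: "?K \<in> borel_measurable lebesgue"
    using assms Times_sets_lebesgue by (simp add: borel_measurable_restrict_space_iff)
  have eq: "?K (x, y) = indicator A x *\<^sub>R (indicator B y *\<^sub>R K (x, y))" for x y
    by (auto simp: indicator_def)
  show "(\<lambda>x. \<integral>y. K (x, y) \<partial>lebesgue_on B) \<in> borel_measurable (lebesgue_on A)"
    using borel_measurable_partial_integral_UNIV[OF K] A B unfolding eq integral_scaleR_right
    by (simp add: borel_measurable_restrict_space_iff integral_restrict_space del: real_scaleR_def)
  have "AE x in lebesgue. (\<lambda>y. ?K (x, y)) \<in> borel_measurable lebesgue"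
    by (rule AE_borel_measurable_slice[OF K])
  then have "AE x in lebesgue. x \<in> A \<longrightarrow> (\<lambda>y. K (x, y)) \<in> borel_measurable (lebesgue_on B)"
    unfolding eq
    by (rule AE_mp) (use B in \<open>intro AE_I2 impI, simp add: borel_measurable_restrict_space_iff del: real_scaleR_def\<close>)
  then show "AE x in lebesgue_on A. (\<lambda>y. K (x, y)) \<in> borel_measurable (lebesgue_on B)"
    using A by (simp add: AE_restrict_space_iff)
qed

lemma
  fixes K :: "'a \<times> 'b \<Rightarrow> real"
  assumes "integrable (lebesgue_on (A \<times> B)) K"
  shows AE_integrable_slice: "AE x in lebesgue_on A. integrable (lebesgue_on B) (\<lambda>y. K (x, y))"
    and integrable_partial_integral: "integrable (lebesgue_on A) (\<lambda>x. \<integral>y. K (x, y) \<partial>lebesgue_on B)"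
    and integral_iterated:
      "integral\<^sup>L (lebesgue_on (A \<times> B)) K = (\<integral>x. \<integral>y. K (x, y) \<partial>lebesgue_on B \<partial>lebesgue_on A)"
proof -
  let ?K = "\<lambda>z. indicator (A \<times> B) z *\<^sub>R K z"
  have K: "integrable lebesgue ?K"
    using assms Times_sets_lebesgue by (simp add: integrable_restrict_space)
  have eq: "?K (x, y) = indicator A x *\<^sub>R (indicator B y *\<^sub>R K (x, y))" for x y
    by (auto simp: indicator_def)
  note F = Fubini_lebesgue_UNIV[OF K, unfolded eq integral_scaleR_right]
  have "AE x in lebesgue. x \<in> A \<longrightarrow> integrable (lebesgue_on B) (\<lambda>y. K (x, y))"
    by (rule AE_mp[OF F(1)]) (use B in \<open>intro AE_I2 impI, simp add: integrable_restrict_space del: real_scaleR_def\<close>)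
  then show "AE x in lebesgue_on A. integrable (lebesgue_on B) (\<lambda>y. K (x, y))"
    using A by (simp add: AE_restrict_space_iff)
  show "integrable (lebesgue_on A) (\<lambda>x. \<integral>y. K (x, y) \<partial>lebesgue_on B)"
    using F(2) A B by (simp add: integrable_restrict_space integral_restrict_space del: real_scaleR_def)
  show "integral\<^sup>L (lebesgue_on (A \<times> B)) K = (\<integral>x. \<integral>y. K (x, y) \<partial>lebesgue_on B \<partial>lebesgue_on A)"
    using F(3) A B Times_sets_lebesgue by (simp add: integral_restrict_space del: real_scaleR_def)
qed

lemma integrable_tensor:
  assumes f: "integrable (lebesgue_on A) f" and g: "integrable (lebesgue_on B) (g :: 'b \<Rightarrow> real)"
  shows "integrable (lebesgue_on (A \<times> B)) (\<lambda>z. f (fst z) * g (snd z))"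
proof -
  let ?f = "\<lambda>x. indicator A x *\<^sub>R f x" and ?g = "\<lambda>x. indicator B x *\<^sub>R g x"
  have f': "integrable lebesgue ?f" and g': "integrable lebesgue ?g"
    using f g A B by (simp_all add: integrable_restrict_space)
  have "integrable lebesgue (\<lambda>z. ?f (fst z) * ?g (snd z))"
  proof (rule Fubini_integrable_lebesgue_UNIV)
    show "(\<lambda>z. ?f (fst z) * ?g (snd z)) \<in> borel_measurable lebesgue"
      using measurable_compose[OF fst_measurable_lebesgue borel_measurable_integrable[OF f']]
        measurable_compose[OF snd_measurable_lebesgue borel_measurable_integrable[OF g']]
      by (rule borel_measurable_times)
    show "AE x in lebesgue. integrable lebesgue (\<lambda>y. ?f (fst (x, y)) * ?g (snd (x, y)))"
      unfolding fst_conv snd_conv using g' by (intro AE_I2 integrable_mult_right)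
    have "integrable lebesgue (\<lambda>x. \<bar>?f x\<bar> * (\<integral>y. \<bar>?g y\<bar> \<partial>lebesgue))"
      using f' by (intro integrable_mult_left integrable_abs)
    then show "integrable lebesgue (\<lambda>x. \<integral>y. \<bar>?f (fst (x, y)) * ?g (snd (x, y))\<bar> \<partial>lebesgue)"
      unfolding fst_conv snd_conv abs_mult integral_mult_right_zero .
  qed
  also have "(\<lambda>z. ?f (fst z) * ?g (snd z)) = (\<lambda>z. indicator (A \<times> B) z *\<^sub>R (f (fst z) * g (snd z)))"
    by (auto simp: indicator_def)
  finally show ?thesis
    using Times_sets_lebesgue by (simp add: integrable_restrict_space)
qed

end

lemma lebesgue_product_swap: "lebesgue_product A B \<Longrightarrow> lebesgue_product B A"
  by (simp add: lebesgue_product_def)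

section \<open>Square-integrable functions\<close>

lemma Lp_2_iff:
  "f \<in> Lp M 2 \<longleftrightarrow> f \<in> borel_measurable M \<and> integrable M (\<lambda>x. (norm (f x))\<^sup>2)"
proof -
  have "norm (f x) powr 2 = (norm (f x))\<^sup>2" for x
    using powr_realpow'[of "norm (f x)" 2] by simp
  then show ?thesis by (simp add: Lp_def)
qed

lemma Lp_2_measurable: "f \<in> Lp M 2 \<Longrightarrow> f \<in> borel_measurable M"
  by (simp add: Lp_2_iff)

lemma integrable_inner_Lp_2:
  assumes "f \<in> Lp M 2" "g \<in> Lp M 2"
  shows "integrable M (\<lambda>x. f x \<bullet> g x)"
proof (rule Bochner_Integration.integrable_bound)
  show "integrable M (\<lambda>x. (norm (f x))\<^sup>2 + (norm (g x))\<^sup>2)"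
    using assms by (simp add: Lp_2_iff)
  show "(\<lambda>x. f x \<bullet> g x) \<in> borel_measurable M"
    using assms by (intro borel_measurable_inner Lp_2_measurable)
  have "\<bar>f x \<bullet> g x\<bar> \<le> (norm (f x))\<^sup>2 + (norm (g x))\<^sup>2" for x
  proof -
    have "\<bar>f x \<bullet> g x\<bar> \<le> norm (f x) * norm (g x)" by (rule Cauchy_Schwarz_ineq2)
    also have "\<dots> \<le> (norm (f x))\<^sup>2 + (norm (g x))\<^sup>2"
      using sum_squares_bound[of "norm (f x)" "norm (g x)"] mult_nonneg_nonneg[OF norm_ge_zero[of "f x"] norm_ge_zero[of "g x"]]
      by linarith
    finally show ?thesis .
  qed
  then show "AE x in M. norm (f x \<bullet> g x) \<le> norm ((norm (f x))\<^sup>2 + (norm (g x))\<^sup>2)"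
    by simp
qed

lemma integrable_times_Lp_2:
  fixes f g :: "'a \<Rightarrow> real"
  assumes "f \<in> Lp M 2" "g \<in> Lp M 2"
  shows "integrable M (\<lambda>x. f x * g x)"
  using integrable_inner_Lp_2[OF assms] by simp

lemma Lp_2_component:
  assumes "f \<in> Lp M 2" "b \<in> Basis"
  shows "(\<lambda>x. f x \<bullet> b) \<in> Lp M 2"
proof -
  have m: "(\<lambda>x. f x \<bullet> b) \<in> borel_measurable M"
    using assms by (intro borel_measurable_inner Lp_2_measurable borel_measurable_const)
  have "integrable M (\<lambda>x. (norm (f x \<bullet> b))\<^sup>2)"
  proof (rule Bochner_Integration.integrable_bound)
    show "integrable M (\<lambda>x. (norm (f x))\<^sup>2)" using assms by (simp add: Lp_2_iff)
    show "AE x in M. norm ((norm (f x \<bullet> b))\<^sup>2) \<le> norm ((norm (f x))\<^sup>2)"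
      using Basis_le_norm[OF assms(2)] by (simp add: abs_le_square_iff[symmetric])
  qed (use m in measurable)
  with m show ?thesis by (simp add: Lp_2_iff)
qed

lemma Lp_2_componentwise:
  fixes f :: "'a \<Rightarrow> 'b::euclidean_space"
  assumes "\<And>b. b \<in> Basis \<Longrightarrow> (\<lambda>x. f x \<bullet> b) \<in> Lp M 2"
  shows "f \<in> Lp M 2"
proof -
  have m: "f \<in> borel_measurable M"
    using assms by (subst borel_measurable_euclidean_space) (simp add: Lp_2_iff)
  have "(norm (f x))\<^sup>2 = (\<Sum>b\<in>Basis. (norm (f x \<bullet> b))\<^sup>2)" for x
    unfolding power2_norm_eq_inner by (subst euclidean_inner) (simp add: power2_eq_square)
  then show ?thesis
    using m assms by (simp add: Lp_2_iff)
qed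

lemma Lp_2_add:
  assumes "f \<in> Lp M 2" "g \<in> Lp M 2"
  shows "(\<lambda>x. f x + g x) \<in> Lp M 2"
proof -
  have "(norm (f x + g x))\<^sup>2 = (norm (f x))\<^sup>2 + (norm (g x))\<^sup>2 + 2 * (f x \<bullet> g x)" for x
    by (simp add: power2_norm_eq_inner inner_add_left inner_add_right inner_commute)
  moreover have "(\<lambda>x. f x + g x) \<in> borel_measurable M"
    using assms by (intro borel_measurable_add Lp_2_measurable)
  ultimately show ?thesis
    using assms integrable_inner_Lp_2[OF assms] by (simp add: Lp_2_iff)
qed

lemma Lp_2_minus: "f \<in> Lp M 2 \<Longrightarrow> (\<lambda>x. - f x) \<in> Lp M 2"
  by (simp add: Lp_2_iff)

text \<open>
  The integral of \<open>(s f + t g)\<^sup>2\<close> is a nonnegative quadratic form in \<open>(s, t)\<close>.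
\<close>

lemma Cauchy_Schwarz_Lp_2:
  fixes f g :: "'a \<Rightarrow> real"
  assumes f: "f \<in> Lp M 2" and g: "g \<in> Lp M 2"
  shows "(\<integral>x. f x * g x \<partial>M)\<^sup>2 \<le> (\<integral>x. (f x)\<^sup>2 \<partial>M) * (\<integral>x. (g x)\<^sup>2 \<partial>M)"
proof -
  define a b c where "a = (\<integral>x. (f x)\<^sup>2 \<partial>M)" and "b = (\<integral>x. (g x)\<^sup>2 \<partial>M)" and "c = (\<integral>x. f x * g x \<partial>M)"
  have i: "integrable M (\<lambda>x. (f x)\<^sup>2)" "integrable M (\<lambda>x. (g x)\<^sup>2)" "integrable M (\<lambda>x. f x * g x)"
    using f g integrable_times_Lp_2[OF f g] by (simp_all add: Lp_2_iff)
  have nn: "0 \<le> s\<^sup>2 * a + t\<^sup>2 * b + 2 * s * t * c" for s t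
  proof -
    have "0 \<le> (\<integral>x. (s * f x + t * g x)\<^sup>2 \<partial>M)" by simp
    also have "\<dots> = (\<integral>x. s\<^sup>2 * (f x)\<^sup>2 + t\<^sup>2 * (g x)\<^sup>2 + 2 * s * t * (f x * g x) \<partial>M)"
      by (intro Bochner_Integration.integral_cong) (auto simp: power2_eq_square algebra_simps)
    also have "\<dots> = s\<^sup>2 * a + t\<^sup>2 * b + 2 * s * t * c"
      using i by (simp add: a_def b_def c_def)
    finally show ?thesis .
  qed
  have "c\<^sup>2 \<le> a * b"
  proof (cases "a = 0")
    case True
    have "c = 0"
    proof (rule ccontr)
      assume "c \<noteq> 0"
      \<comment> \<open>For \<open>a = 0\<close> and \<open>t = 1\<close> the form is \<open>b + 2 s c\<close>, which this \<open>s\<close> makes \<open>-1\<close>.\<close>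
      then have "2 * (-(b + 1) / (2 * c)) * 1 * c = - (b + 1)" by simp
      with nn[of "-(b + 1) / (2 * c)" 1] True show False by simp
    qed
    with True show ?thesis by simp
  next
    case False
    moreover have "a \<ge> 0" unfolding a_def by (rule integral_nonneg_AE) simp
    ultimately have "a > 0" by simp
    \<comment> \<open>The minimizing direction is \<open>(s, t) = (-c, a)\<close>.\<close>
    moreover have "0 \<le> a * (a * b - c\<^sup>2)"
      using nn[of "- c" a] by (simp add: power2_eq_square algebra_simps)
    ultimately show ?thesis by (simp add: zero_le_mult_iff)
  qed
  then show ?thesis by (simp add: a_def b_def c_def)
qed

context lebesgue_product
begin

lemma Lp_2_swap:
  fixes K :: "'a \<times> 'b \<Rightarrow> real"
  assumes "K \<in> Lp (lebesgue_on (A \<times> B)) 2"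
  shows "(\<lambda>z. K (prod.swap z)) \<in> Lp (lebesgue_on (B \<times> A)) 2"
proof -
  have K: "K \<in> borel_measurable (lebesgue_on (A \<times> B))"
    using assms by (simp add: Lp_2_iff)
  have "(\<lambda>z. K (prod.swap z)) \<in> borel_measurable (lebesgue_on (B \<times> A))"
    by (rule measurable_compose[OF swap_measurable_lebesgue_on K])
  moreover have "(\<lambda>z. (norm (K z))\<^sup>2) \<in> borel_measurable (lebesgue_on (A \<times> B))"
    using K by simp
  from integral_swap(1)[OF this] assms
  have "integrable (lebesgue_on (B \<times> A)) (\<lambda>z. (norm (K (prod.swap z)))\<^sup>2)"
    by (simp add: Lp_2_iff)
  ultimately show ?thesis by (simp add: Lp_2_iff)
qed

lemma Lp_2_tensor:
  assumes f: "f \<in> Lp (lebesgue_on A) 2" and g: "(g :: 'b \<Rightarrow> real) \<in> Lp (lebesgue_on B) 2"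
  shows "(\<lambda>z. f (fst z) * g (snd z)) \<in> Lp (lebesgue_on (A \<times> B)) 2"
proof -
  have "(\<lambda>z. f (fst z) * g (snd z)) \<in> borel_measurable (lebesgue_on (A \<times> B))"
    using measurable_compose[OF fst_measurable_lebesgue_on Lp_2_measurable[OF f]]
      measurable_compose[OF snd_measurable_lebesgue_on Lp_2_measurable[OF g]]
    by (rule borel_measurable_times)
  then show ?thesis
    using integrable_tensor[of "\<lambda>x. (f x)\<^sup>2" "\<lambda>y. (g y)\<^sup>2"] f g
    by (simp add: Lp_2_iff power_mult_distrib)
qed

lemma integral_tensor:
  assumes f: "integrable (lebesgue_on A) f" and g: "integrable (lebesgue_on B) (g :: 'b \<Rightarrow> real)"
  shows "(\<integral>z. f (fst z) * g (snd z) \<partial>lebesgue_on (A \<times> B))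
    = (\<integral>x. f x \<partial>lebesgue_on A) * (\<integral>y. g y \<partial>lebesgue_on B)"
  using integral_iterated[OF integrable_tensor[OF f g]] by simp


lemma AE_Lp_2_slice:
  fixes K :: "'a \<times> 'b \<Rightarrow> real"
  assumes K: "K \<in> Lp (lebesgue_on (A \<times> B)) 2"
  shows "AE x in lebesgue_on A. (\<lambda>y. K (x, y)) \<in> Lp (lebesgue_on B) 2"
proof -
  have "AE x in lebesgue_on A. integrable (lebesgue_on B) (\<lambda>y. (norm (K (x, y)))\<^sup>2)"
    using K by (intro AE_integrable_slice) (simp add: Lp_2_iff)
  moreover have "AE x in lebesgue_on A. (\<lambda>y. K (x, y)) \<in> borel_measurable (lebesgue_on B)"
    by (rule borel_measurable_partial_integral(2)[OF Lp_2_measurable[OF K]])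
  ultimately show ?thesis
    by eventually_elim (simp add: Lp_2_iff)
qed

text \<open>
  By the Cauchy-Schwarz inequality on almost every slice, the square of the integral is at most a constant times
  \<open>\<integral> (K(x, y))\<^sup>2 dy\<close>, which is integrable in \<open>x\<close>.
\<close>

lemma Lp_2_partial_integral:
  fixes K :: "'a \<times> 'b \<Rightarrow> real"
  assumes K: "K \<in> Lp (lebesgue_on (A \<times> B)) 2" and g: "g \<in> Lp (lebesgue_on B) 2"
  shows "(\<lambda>x. \<integral>y. g y * K (x, y) \<partial>lebesgue_on B) \<in> Lp (lebesgue_on A) 2"
proof -
  let ?H = "\<lambda>x. \<integral>y. g y * K (x, y) \<partial>lebesgue_on B"
  have "(\<lambda>z. g (snd z) * K z) \<in> borel_measurable (lebesgue_on (A \<times> B))"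
    using measurable_compose[OF snd_measurable_lebesgue_on Lp_2_measurable[OF g]] Lp_2_measurable[OF K]
    by (rule borel_measurable_times)
  from borel_measurable_partial_integral(1)[OF this]
  have m: "?H \<in> borel_measurable (lebesgue_on A)" by simp
  have "integrable (lebesgue_on A) (\<lambda>x. (norm (?H x))\<^sup>2)"
  proof (rule Bochner_Integration.integrable_bound)
    show "integrable (lebesgue_on A)
        (\<lambda>x. (\<integral>y. (g y)\<^sup>2 \<partial>lebesgue_on B) * (\<integral>y. (K (x, y))\<^sup>2 \<partial>lebesgue_on B))"
      using integrable_partial_integral[of "\<lambda>z. (K z)\<^sup>2"] K by (simp add: Lp_2_iff)
    show "AE x in lebesgue_on A. norm ((norm (?H x))\<^sup>2)
        \<le> norm ((\<integral>y. (g y)\<^sup>2 \<partial>lebesgue_on B) * (\<integral>y. (K (x, y))\<^sup>2 \<partial>lebesgue_on B))"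
      using AE_Lp_2_slice[OF K]
    proof eventually_elim
      case (elim x)
      from Cauchy_Schwarz_Lp_2[OF g elim] show ?case by (simp add: abs_mult)
    qed
  qed (use m in simp)
  with m show ?thesis by (simp add: Lp_2_iff)
qed

end

section \<open>Continuously differentiable functions\<close>

lemma C_k_const: "C_k k (\<lambda>x::'a::euclidean_space. c)"
  by (induction k arbitrary: c) (simp_all add: frechet_derivative_const)

lemma C_k_Suc_imp: "C_k (Suc k) f \<Longrightarrow> C_k k f"
proof (induction k arbitrary: f)
  case 0
  then show ?case by (simp add: differentiable_imp_continuous_on)
next
  case (Suc k)
  then show ?case by (metis C_k.simps(2))
qed

lemma C_k_Suc_differentiable: "C_k (Suc k) f \<Longrightarrow> f differentiable (at x)"
  by (simp add: differentiable_on_def)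

lemma frechet_derivative_eqI:
  "(f has_derivative D) (at x) \<Longrightarrow> frechet_derivative f (at x) h = D h"
  using frechet_derivative_at by metis

lemma C_k_has_derivative:
  "C_k (Suc k) f \<Longrightarrow> (f has_derivative frechet_derivative f (at x)) (at x)"
  using C_k_Suc_differentiable frechet_derivative_works by blast

lemma C_k_add: "C_k k f \<Longrightarrow> C_k k g \<Longrightarrow> C_k k (\<lambda>x. f x + g x)"
proof (induction k arbitrary: f g)
  case 0
  then show ?case by (auto intro: continuous_intros)
next
  case (Suc k)
  have "frechet_derivative (\<lambda>x. f x + g x) (at x) b
      = frechet_derivative f (at x) b + frechet_derivative g (at x) b" for x b
    using frechet_derivative_eqI[OF has_derivative_add[OF C_k_has_derivative[OF Suc.prems(1)]
      C_k_has_derivative[OF Suc.prems(2)]]] by simp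
  with Suc show ?case by (auto intro: differentiable_on_add)
qed

lemma C_k_mult: "C_k k f \<Longrightarrow> C_k k g \<Longrightarrow> C_k k (\<lambda>x. f x * g x)"
proof (induction k arbitrary: f g)
  case 0
  then show ?case by (auto intro: continuous_intros)
next
  case (Suc k)
  have "frechet_derivative (\<lambda>x. f x * g x) (at x) b
      = f x * frechet_derivative g (at x) b + frechet_derivative f (at x) b * g x" for x b
    using frechet_derivative_eqI[OF has_derivative_mult[OF C_k_has_derivative[OF Suc.prems(1)]
      C_k_has_derivative[OF Suc.prems(2)]]] by simp
  with Suc C_k_Suc_imp[OF Suc.prems(1)] C_k_Suc_imp[OF Suc.prems(2)] show ?case
    by (auto intro: differentiable_on_mult C_k_add)
qed

lemma C_k_sum:
  "finite I \<Longrightarrow> (\<And>i. i \<in> I \<Longrightarrow> C_k k (f i)) \<Longrightarrow> C_k k (\<lambda>x. \<Sum>i\<in>I. f i x)"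
  by (induction I rule: finite_induct) (auto intro: C_k_add C_k_const)

lemma C_k_prod:
  "finite I \<Longrightarrow> (\<And>i. i \<in> I \<Longrightarrow> C_k k (f i)) \<Longrightarrow> C_k k (\<lambda>x. \<Prod>i\<in>I. f i x)"
  by (induction I rule: finite_induct) (auto intro: C_k_mult C_k_const)

lemma frechet_derivative_affine:
  fixes f :: "'b::euclidean_space \<Rightarrow> real" and L :: "'a::euclidean_space \<Rightarrow> 'b"
  assumes L: "bounded_linear L" and f: "\<And>x. f differentiable (at x)"
  shows "(\<lambda>x. f (L x + c)) differentiable (at x)"
    and "frechet_derivative (\<lambda>x. f (L x + c)) (at x) h = frechet_derivative f (at (L x + c)) (L h)"
proof -
  have L': "((\<lambda>x. L x + c) has_derivative L) (at x)"
    by (auto intro!: derivative_eq_intros bounded_linear_imp_has_derivative[OF L])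
  have "(f has_derivative frechet_derivative f (at (L x + c))) (at (L x + c))"
    using f frechet_derivative_works by blast
  from has_derivative_compose[OF L' this]
  have d: "((\<lambda>x. f (L x + c)) has_derivative (\<lambda>h. frechet_derivative f (at (L x + c)) (L h))) (at x)" .
  then show "(\<lambda>x. f (L x + c)) differentiable (at x)" by (rule differentiableI)
  show "frechet_derivative (\<lambda>x. f (L x + c)) (at x) h = frechet_derivative f (at (L x + c)) (L h)"
    using frechet_derivative_at[OF d] by metis
qed

text \<open>
  The partial derivatives of the composition are constant linear combinations of those of \<open>f\<close>, composed with the
  same map.  Slices, tensor products, exchange of factors and the one-dimensional profiles of the bump functions
  are all compositions of this kind.
\<close>

lemma C_k_affine:
  fixes f :: "'b::euclidean_space \<Rightarrow> real" and L :: "'a::euclidean_space \<Rightarrow> 'b"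
  assumes L: "bounded_linear L" and f: "C_k k f"
  shows "C_k k (\<lambda>x. f (L x + c))"
  using f
proof (induction k arbitrary: f)
  case 0
  have "continuous_on UNIV (\<lambda>x. L x + c)"
    using linear_continuous_on[OF L] by (intro continuous_intros)
  with 0 show ?case
    by (simp add: continuous_on_compose2[of UNIV f])
next
  case (Suc k)
  have df: "f differentiable (at x)" for x
    using C_k_Suc_differentiable[OF Suc.prems] .
  have "frechet_derivative (\<lambda>x. f (L x + c)) (at x) h
      = (\<Sum>b\<in>Basis. (L h \<bullet> b) * frechet_derivative f (at (L x + c)) b)" for x h
  proof -
    have lin: "linear (frechet_derivative f (at (L x + c)))"
      using df by (rule linear_frechet_derivative)
    have "frechet_derivative (\<lambda>x. f (L x + c)) (at x) h
        = frechet_derivative f (at (L x + c)) (\<Sum>b\<in>Basis. (L h \<bullet> b) *\<^sub>R b)"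
      by (simp add: frechet_derivative_affine[OF L df] euclidean_representation)
    also have "\<dots> = (\<Sum>b\<in>Basis. (L h \<bullet> b) * frechet_derivative f (at (L x + c)) b)"
      using lin by (simp add: linear_sum linear_scale)
    finally show ?thesis .
  qed
  moreover have "C_k k (\<lambda>x. \<Sum>b\<in>Basis. (L h \<bullet> b) * frechet_derivative f (at (L x + c)) b)" for h
    using Suc.prems by (intro C_k_sum C_k_mult C_k_const finite_Basis Suc.IH) simp
  ultimately show ?case
    using frechet_derivative_affine(1)[OF L df] by (simp add: differentiable_on_def)
qed

section \<open>Test functions\<close>

lemma test_function_C_k: "test_function \<Omega> \<phi> \<Longrightarrow> C_k k \<phi>"
  by (simp add: test_function_def)

lemma test_function_differentiable: "test_function \<Omega> \<phi> \<Longrightarrow> \<phi> differentiable (at x)"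
  using test_function_C_k C_k_Suc_differentiable by blast

lemma test_function_partial:
  assumes \<phi>: "test_function \<Omega> \<phi>" and b: "b \<in> Basis"
  shows "test_function \<Omega> (\<lambda>x. frechet_derivative \<phi> (at x) b)"
proof -
  obtain K where K: "compact K" "K \<subseteq> \<Omega>" "\<And>x. x \<notin> K \<Longrightarrow> \<phi> x = 0"
    using \<phi> unfolding test_function_def by blast
  have "frechet_derivative \<phi> (at x) b = 0" if "x \<notin> K" for x
  proof (rule frechet_derivative_eqI[where D = "\<lambda>_. 0"])
    have "open (- K)" using K(1) by (simp add: compact_imp_closed open_Compl)
    then show "(\<phi> has_derivative (\<lambda>_. 0)) (at x)"
      by (rule has_derivative_transform_within_open[OF has_derivative_const]) (use K(3) that in auto)
  qed
  moreover have "C_k k (\<lambda>x. frechet_derivative \<phi> (at x) b)" for k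
    using test_function_C_k[OF \<phi>, of "Suc k"] b by simp
  ultimately show ?thesis
    using K(1,2) unfolding test_function_def by blast
qed

text \<open>
  Test functions and, by \<open>test_function_partial\<close>, their derivatives may thus be paired with any square-integrable
  function.
\<close>

lemma test_function_Lp_2:
  assumes \<phi>: "test_function \<Omega> \<phi>" and \<Omega>: "\<Omega> \<in> sets lebesgue"
  shows "\<phi> \<in> Lp (lebesgue_on \<Omega>) 2"
proof -
  obtain K where K: "compact K" "K \<subseteq> \<Omega>" "\<And>x. x \<notin> K \<Longrightarrow> \<phi> x = 0"
    using \<phi> unfolding test_function_def by blast
  have cont: "continuous_on UNIV \<phi>"
    using test_function_C_k[OF \<phi>, of 0] by simp
  have m: "\<phi> \<in> borel_measurable (lebesgue_on \<Omega>)"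
    by (intro measurable_restrict_space1 borel_measurable_imp_lebesgue borel_measurable_continuous_onI cont)
  have "integrable lborel (\<lambda>x. indicator K x *\<^sub>R (\<phi> x)\<^sup>2)"
    by (rule borel_integrable_compact[OF K(1)])
      (intro continuous_intros continuous_on_subset[OF cont] subset_UNIV)
  also have "(\<lambda>x. indicator K x *\<^sub>R (\<phi> x)\<^sup>2) = (\<lambda>x. (\<phi> x)\<^sup>2)"
    by (rule ext) (use K(3) in \<open>auto simp: indicator_def\<close>)
  finally have i: "integrable lborel (\<lambda>x. (\<phi> x)\<^sup>2)" .
  then have "integrable lebesgue (\<lambda>x. (\<phi> x)\<^sup>2)"
    by (simp add: integrable_completion[OF borel_measurable_integrable[OF i]])
  then have "integrable (lebesgue_on \<Omega>) (\<lambda>x. (\<phi> x)\<^sup>2)"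
    using integrable_mult_indicator[OF \<Omega>] \<Omega>
    by (simp add: integrable_restrict_space del: real_scaleR_def)
  with m show ?thesis by (simp add: Lp_2_iff)
qed

lemma test_function_tensor:
  assumes \<phi>: "test_function A \<phi>" and \<psi>: "test_function B \<psi>"
  shows "test_function (A \<times> B) (\<lambda>z. \<phi> (fst z) * \<psi> (snd z))"
proof -
  obtain K where K: "compact K" "K \<subseteq> A" "\<And>x. x \<notin> K \<Longrightarrow> \<phi> x = 0"
    using \<phi> unfolding test_function_def by blast
  obtain L where L: "compact L" "L \<subseteq> B" "\<And>x. x \<notin> L \<Longrightarrow> \<psi> x = 0"
    using \<psi> unfolding test_function_def by blast
  have "C_k k (\<lambda>z. \<phi> (fst z) * \<psi> (snd z))" for k
    using C_k_affine[OF bounded_linear_fst test_function_C_k[OF \<phi>], of k 0]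
      C_k_affine[OF bounded_linear_snd test_function_C_k[OF \<psi>], of k 0]
    by (intro C_k_mult) simp_all
  moreover have "compact (K \<times> L)" "K \<times> L \<subseteq> A \<times> B"
    using K L by (auto intro: compact_Times)
  moreover have "z \<notin> K \<times> L \<Longrightarrow> \<phi> (fst z) * \<psi> (snd z) = 0" for z
    using K(3) L(3) by (cases z) auto
  ultimately show ?thesis
    unfolding test_function_def by (intro conjI allI exI[of _ "K \<times> L"]) simp_all
qed

lemma frechet_derivative_tensor_fst:
  assumes \<phi>: "test_function A \<phi>" and \<psi>: "test_function B \<psi>"
  shows "frechet_derivative (\<lambda>z. \<phi> (fst z) * \<psi> (snd z)) (at z) (b, 0)
    = frechet_derivative \<phi> (at (fst z)) b * \<psi> (snd z)"
proof -
  have d: "((\<lambda>z. f (l z)) has_derivative (\<lambda>h. frechet_derivative f (at (l z)) (l h))) (at z)"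
    if "test_function C f" "bounded_linear l" for f :: "'c::euclidean_space \<Rightarrow> real" and l :: "'a \<times> 'b \<Rightarrow> 'c" and C z
    using has_derivative_compose[OF bounded_linear_imp_has_derivative[OF that(2)]
        C_k_has_derivative[OF test_function_C_k[OF that(1)]]] .
  have "linear (frechet_derivative \<psi> (at (snd z)))"
    by (rule linear_frechet_derivative[OF test_function_differentiable[OF \<psi>]])
  then have "frechet_derivative \<psi> (at (snd z)) 0 = 0" by (rule linear_0)
  then show ?thesis
    using frechet_derivative_eqI[OF has_derivative_mult[OF d[OF \<phi> bounded_linear_fst] d[OF \<psi> bounded_linear_snd]],
      of z "(b, 0)"] by simp
qed

text \<open>
  The slice is supported in the projection of the support, which lies in \<open>A\<close> even when \<open>y\<close> is outside \<open>B\<close>.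
\<close>

lemma test_function_slice:
  assumes \<phi>: "test_function (A \<times> B) \<phi>"
  shows "test_function A (\<lambda>x. \<phi> (x, y))"
    and "frechet_derivative (\<lambda>x. \<phi> (x, y)) (at x) b = frechet_derivative \<phi> (at (x, y)) (b, 0)"
proof -
  have L: "bounded_linear (\<lambda>x. (x, 0))" by (intro bounded_linear_intros)
  obtain K where K: "compact K" "K \<subseteq> A \<times> B" "\<And>x. x \<notin> K \<Longrightarrow> \<phi> x = 0"
    using \<phi> unfolding test_function_def by blast
  have "C_k k (\<lambda>x. \<phi> (x, y))" for k
    using C_k_affine[OF L test_function_C_k[OF \<phi>], of k "(0, y)"] by simp
  moreover have "compact (fst ` K)" "fst ` K \<subseteq> A"
    using K by (auto intro!: compact_continuous_image continuous_intros)
  moreover have "x \<notin> fst ` K \<Longrightarrow> \<phi> (x, y) = 0" for x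
    by (rule K(3)) force
  ultimately show "test_function A (\<lambda>x. \<phi> (x, y))"
    unfolding test_function_def by blast
  show "frechet_derivative (\<lambda>x. \<phi> (x, y)) (at x) b = frechet_derivative \<phi> (at (x, y)) (b, 0)"
    using frechet_derivative_affine(2)[OF L test_function_differentiable[OF \<phi>], of "(0, y)"] by simp
qed

lemma bounded_linear_swap: "bounded_linear prod.swap"
  unfolding prod.swap_def[abs_def]
  by (intro bounded_linear_Pair bounded_linear_fst bounded_linear_snd)

lemma test_function_swap:
  assumes \<phi>: "test_function (A \<times> B) \<phi>"
  shows "test_function (B \<times> A) (\<lambda>z. \<phi> (prod.swap z))"
    and "frechet_derivative (\<lambda>z. \<phi> (prod.swap z)) (at z) h
      = frechet_derivative \<phi> (at (prod.swap z)) (prod.swap h)"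
proof -
  obtain K where K: "compact K" "K \<subseteq> A \<times> B" "\<And>x. x \<notin> K \<Longrightarrow> \<phi> x = 0"
    using \<phi> unfolding test_function_def by blast
  have "C_k k (\<lambda>z. \<phi> (prod.swap z))" for k
    using C_k_affine[OF bounded_linear_swap test_function_C_k[OF \<phi>], of k 0] by simp
  moreover have "compact (prod.swap ` K)" "prod.swap ` K \<subseteq> B \<times> A"
    using K by (auto intro!: compact_continuous_image continuous_on_swap)
  moreover have "z \<notin> prod.swap ` K \<Longrightarrow> \<phi> (prod.swap z) = 0" for z
    by (rule K(3)) (metis image_eqI swap_swap)
  ultimately show "test_function (B \<times> A) (\<lambda>z. \<phi> (prod.swap z))"
    unfolding test_function_def by blast
  show "frechet_derivative (\<lambda>z. \<phi> (prod.swap z)) (at z) h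
      = frechet_derivative \<phi> (at (prod.swap z)) (prod.swap h)"
    using frechet_derivative_affine(2)[OF bounded_linear_swap test_function_differentiable[OF \<phi>], of 0] by simp
qed

section \<open>The fundamental lemma of the calculus of variations\<close>

text \<open>
  For \<open>n = 0\<close> this is the classical smooth function that vanishes to infinite order at the origin.  The powers of
  \<open>1 / t\<close> are there because they appear in its derivatives: the family spans a space closed under differentiation.
\<close>

definition flat_exp :: "nat \<Rightarrow> real \<Rightarrow> real" where
  "flat_exp n t = (if t > 0 then (1 / t) ^ n * exp (- (1 / t)) else 0)"

lemma flat_exp_tendsto_0: "(flat_exp n \<longlongrightarrow> 0) (at_right 0)"
proof -
  have "((\<lambda>s::real. s ^ n / exp s) \<longlongrightarrow> 0) at_top"
    by (rule tendsto_power_div_exp_0)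
  then have "((\<lambda>t::real. inverse t ^ n / exp (inverse t)) \<longlongrightarrow> 0) (at_right 0)"
    by (rule filterlim_compose[OF _ filterlim_inverse_at_top_right])
  then show ?thesis
    by (rule Lim_transform_eventually)
      (auto simp: flat_exp_def exp_minus divide_simps eventually_at_filter)
qed

text \<open>
  At the origin the difference quotient of \<open>flat_exp n\<close> is \<open>flat_exp (n + 1)\<close> on the right and zero on the left.
\<close>

lemma flat_exp_deriv:
  "(flat_exp n has_real_derivative (flat_exp (n + 2) t - real n * flat_exp (n + 1) t)) (at t)"
proof -
  consider "t > 0" | "t < 0" | "t = 0" by linarith
  then show ?thesis
  proof cases
    case 1
    have "((\<lambda>t. (1 / t) ^ n * exp (- (1 / t))) has_real_derivative
        (flat_exp (n + 2) t - real n * flat_exp (n + 1) t)) (at t)"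
    proof -
      have r: "((\<lambda>t. 1 / t) has_real_derivative - (1 / t)\<^sup>2) (at t)"
        using 1 by (auto intro!: derivative_eq_intros simp: power2_eq_square field_simps)
      have "((\<lambda>t. (1 / t) ^ n * exp (- (1 / t))) has_real_derivative
          real n * (- (1 / t)\<^sup>2 * (1 / t) ^ (n - Suc 0)) * exp (- (1 / t))
          + exp (- (1 / t)) * (- (- (1 / t)\<^sup>2)) * (1 / t) ^ n) (at t)"
        by (intro DERIV_mult DERIV_power DERIV_fun_exp DERIV_minus r)
      moreover have "real n * (- (1 / t)\<^sup>2 * (1 / t) ^ (n - Suc 0)) * exp (- (1 / t))
          + exp (- (1 / t)) * (- (- (1 / t)\<^sup>2)) * (1 / t) ^ n
          = flat_exp (n + 2) t - real n * flat_exp (n + 1) t"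
        using 1 by (cases n) (simp_all add: flat_exp_def power2_eq_square algebra_simps)
      ultimately show ?thesis by simp
    qed
    then show ?thesis
      by (rule has_field_derivative_transform_within_open[of _ _ _ "{0<..}"])
        (use 1 in \<open>auto simp: flat_exp_def\<close>)
  next
    case 2
    have "((\<lambda>t::real. 0) has_real_derivative (flat_exp (n + 2) t - real n * flat_exp (n + 1) t)) (at t)"
      using 2 by (auto intro!: derivative_eq_intros simp: flat_exp_def)
    then show ?thesis
      by (rule has_field_derivative_transform_within_open[of _ _ _ "{..<0}"])
        (use 2 in \<open>auto simp: flat_exp_def\<close>)
  next
    case 3
    have "((\<lambda>h. flat_exp n h / h) \<longlongrightarrow> 0) (at_right 0)"
      using flat_exp_tendsto_0[of "n + 1"]
      by (rule Lim_transform_eventually)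
        (auto simp: flat_exp_def eventually_at_filter divide_simps)
    moreover have "((\<lambda>h. flat_exp n h / h) \<longlongrightarrow> 0) (at_left 0)"
      by (rule tendsto_eventually) (auto simp: flat_exp_def eventually_at_filter)
    ultimately have "((\<lambda>h. flat_exp n h / h) \<longlongrightarrow> 0) (at 0)"
      by (rule filterlim_split_at[rotated])
    then show ?thesis
      using 3 by (simp add: has_field_derivative_iff flat_exp_def)
  qed
qed

lemma C_k_flat_exp: "C_k k (flat_exp n)"
proof (induction k arbitrary: n)
  case 0
  show ?case
    by (auto intro!: continuous_at_imp_continuous_on DERIV_isCont[OF flat_exp_deriv])
next
  case (Suc k)
  have d: "(flat_exp n has_derivative (*) (flat_exp (n + 2) t - real n * flat_exp (n + 1) t)) (at t)" for t
    using flat_exp_deriv by (simp add: has_field_derivative_def)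
  have "frechet_derivative (flat_exp n) (at t) 1 = flat_exp (n + 2) t + (- real n) * flat_exp (n + 1) t" for t
    using frechet_derivative_at[OF d, symmetric] by simp
  moreover have "flat_exp n differentiable_on UNIV"
    using d by (auto simp: differentiable_on_def intro: differentiableI)
  moreover have "C_k k (\<lambda>t. flat_exp (n + 2) t + (- real n) * flat_exp (n + 1) t)"
    by (intro C_k_add C_k_mult C_k_const Suc)
  ultimately show ?case by simp
qed

text \<open>
  Since \<open>flat_exp 0 (n s)\<close> tends to \<open>1\<close> for \<open>s > 0\<close> and is \<open>0\<close> otherwise, these test functions tend pointwise to the
  indicator of the open box, and they are bounded by the indicator of the closed one.
\<close>

definition box_bump :: "'a::euclidean_space \<Rightarrow> 'a \<Rightarrow> nat \<Rightarrow> 'a \<Rightarrow> real" where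
  "box_bump a b n x = (\<Prod>i\<in>Basis.
     flat_exp 0 (real (Suc n) * (x \<bullet> i - a \<bullet> i)) * flat_exp 0 (real (Suc n) * (b \<bullet> i - x \<bullet> i)))"

lemma box_bump_outside:
  assumes x: "x \<notin> cbox a b"
  shows "box_bump a b n x = 0"
proof -
  obtain i where i: "i \<in> Basis" "x \<bullet> i < a \<bullet> i \<or> b \<bullet> i < x \<bullet> i"
    using x unfolding mem_box by force
  then have "flat_exp 0 (real (Suc n) * (x \<bullet> i - a \<bullet> i)) * flat_exp 0 (real (Suc n) * (b \<bullet> i - x \<bullet> i)) = 0"
    by (auto simp: flat_exp_def zero_less_mult_iff)
  then show ?thesis
    unfolding box_bump_def using i(1) by (intro prod_zero) auto
qed

lemma test_function_box_bump:
  assumes "cbox a b \<subseteq> \<Omega>"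
  shows "test_function \<Omega> (box_bump a b n)"
proof -
  have "C_k k (\<lambda>x. flat_exp 0 (real (Suc n) * (x \<bullet> i - a \<bullet> i)) * flat_exp 0 (real (Suc n) * (b \<bullet> i - x \<bullet> i)))"
    for k and i :: 'a
  proof (rule C_k_mult)
    have L: "bounded_linear (\<lambda>x. c * (x \<bullet> i))" for c
      by (intro bounded_linear_intros)
    show "C_k k (\<lambda>x. flat_exp 0 (real (Suc n) * (x \<bullet> i - a \<bullet> i)))"
      using C_k_affine[OF L C_k_flat_exp, of k 0 "real (Suc n)" "- real (Suc n) * (a \<bullet> i)"]
      by (simp add: algebra_simps)
    show "C_k k (\<lambda>x. flat_exp 0 (real (Suc n) * (b \<bullet> i - x \<bullet> i)))"
      using C_k_affine[OF L C_k_flat_exp, of k 0 "- real (Suc n)" "real (Suc n) * (b \<bullet> i)"]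
      by (simp add: algebra_simps)
  qed
  then have "C_k k (box_bump a b n)" for k
    unfolding box_bump_def by (intro C_k_prod finite_Basis)
  moreover have "x \<notin> cbox a b \<Longrightarrow> box_bump a b n x = 0" for x
    by (rule box_bump_outside)
  ultimately show ?thesis
    using assms unfolding test_function_def
    by (intro conjI allI exI[of _ "cbox a b"]) (simp_all add: compact_cbox)
qed

lemma box_bump_bounds: "0 \<le> box_bump a b n x" "box_bump a b n x \<le> 1"
proof -
  have *: "0 \<le> flat_exp 0 t" "flat_exp 0 t \<le> 1" for t
    by (auto simp: flat_exp_def)
  show "0 \<le> box_bump a b n x" "box_bump a b n x \<le> 1"
    unfolding box_bump_def using * by (auto intro!: prod_nonneg prod_le_1 mult_le_one)
qed

lemma flat_exp_scaled_tendsto: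
  "(\<lambda>n. flat_exp 0 (real (Suc n) * s)) \<longlonglongrightarrow> (if s > 0 then 1 else 0)"
proof (cases "s > 0")
  case True
  have "(\<lambda>n. exp (- (inverse (real (Suc n)) * (1 / s)))) \<longlonglongrightarrow> exp (- (0 * (1 / s)))"
    by (intro tendsto_intros LIMSEQ_inverse_real_of_nat)
  moreover have "flat_exp 0 (real (Suc n) * s) = exp (- (inverse (real (Suc n)) * (1 / s)))" for n
    using True by (simp add: flat_exp_def divide_simps zero_less_mult_iff)
  ultimately show ?thesis using True by simp
next
  case False
  then have "flat_exp 0 (real (Suc n) * s) = 0" for n
    by (simp add: flat_exp_def zero_less_mult_iff)
  with False show ?thesis by simp
qed

lemma box_bump_tendsto: "(\<lambda>n. box_bump a b n x) \<longlonglongrightarrow> indicator (box a b) x"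
proof -
  have "(\<lambda>n. box_bump a b n x) \<longlonglongrightarrow>
      (\<Prod>i\<in>Basis. (if x \<bullet> i - a \<bullet> i > 0 then 1 else 0) * (if b \<bullet> i - x \<bullet> i > 0 then 1 else 0))"
    unfolding box_bump_def by (intro tendsto_prod tendsto_mult flat_exp_scaled_tendsto)
  also have "(\<Prod>i\<in>Basis. (if x \<bullet> i - a \<bullet> i > 0 then 1 else 0) * (if b \<bullet> i - x \<bullet> i > 0 then 1 else 0))
      = (indicator (box a b) x :: real)"
  proof (cases "x \<in> box a b")
    case True
    then show ?thesis by (auto simp: mem_box intro!: prod.neutral)
  next
    case False
    then obtain i where i: "i \<in> Basis" "x \<bullet> i \<le> a \<bullet> i \<or> b \<bullet> i \<le> x \<bullet> i"
      unfolding mem_box by force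
    have "(\<Prod>i\<in>Basis. (if x \<bullet> i - a \<bullet> i > 0 then 1 else 0) * (if b \<bullet> i - x \<bullet> i > 0 then 1 else 0)) = (0 :: real)"
      by (intro prod_zero finite_Basis bexI[of _ i]) (use i in auto)
    with False show ?thesis by simp
  qed
  finally show ?thesis .
qed

lemma indicator_cbox_Lp_2:
  assumes \<Omega>: "\<Omega> \<in> sets lebesgue"
  shows "(indicator (cbox a b) :: 'a::euclidean_space \<Rightarrow> real) \<in> Lp (lebesgue_on \<Omega>) 2"
proof -
  have i: "integrable lebesgue (indicator (cbox a b) :: 'a \<Rightarrow> real)"
    by (simp add: emeasure_lborel_cbox_eq)
  then have "integrable (lebesgue_on \<Omega>) (indicator (cbox a b) :: 'a \<Rightarrow> real)"
    using integrable_mult_indicator[OF \<Omega> i] \<Omega>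
    by (simp add: integrable_restrict_space del: real_scaleR_def)
  moreover have "(\<lambda>x. (norm (indicator (cbox a b) x :: real))\<^sup>2) = indicator (cbox a b)"
    by (auto simp: indicator_def)
  ultimately show ?thesis
    using borel_measurable_integrable by (simp add: Lp_2_iff)
qed

text \<open>
  Dominated convergence along \<open>box_bump\<close>, with dominating function \<open>\<bar>f\<bar>\<close> on the closed box.
\<close>

lemma integral_box_eq_0:
  fixes f :: "'a::euclidean_space \<Rightarrow> real"
  assumes \<Omega>: "\<Omega> \<in> sets lebesgue" and f: "f \<in> Lp (lebesgue_on \<Omega>) 2"
    and orth: "\<And>\<phi>. test_function \<Omega> \<phi> \<Longrightarrow> (\<integral>x. f x * \<phi> x \<partial>lebesgue_on \<Omega>) = 0"
    and box: "cbox a b \<subseteq> \<Omega>"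
  shows "(\<integral>x. f x * indicator (box a b) x \<partial>lebesgue_on \<Omega>) = 0"
proof -
  note ind = integrable_times_Lp_2[OF f indicator_cbox_Lp_2[OF \<Omega>]]
  have meas: "(\<lambda>x. f x * box_bump a b n x) \<in> borel_measurable (lebesgue_on \<Omega>)" for n
    by (intro borel_measurable_times Lp_2_measurable[OF f]
        Lp_2_measurable[OF test_function_Lp_2[OF test_function_box_bump[OF box] \<Omega>]])
  have lim: "(\<lambda>n. f x * box_bump a b n x) \<longlonglongrightarrow> f x * indicator (box a b) x" for x
    by (intro tendsto_mult tendsto_const box_bump_tendsto)
  have "(\<lambda>n. \<integral>x. f x * box_bump a b n x \<partial>lebesgue_on \<Omega>)
      \<longlonglongrightarrow> (\<integral>x. f x * indicator (box a b) x \<partial>lebesgue_on \<Omega>)"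
  proof (rule integral_dominated_convergence[where w = "\<lambda>x. \<bar>f x * indicator (cbox a b) x\<bar>"])
    show "(\<lambda>x. f x * indicator (box a b) x) \<in> borel_measurable (lebesgue_on \<Omega>)"
      by (rule borel_measurable_LIMSEQ_metric[OF meas lim])
    show "integrable (lebesgue_on \<Omega>) (\<lambda>x. \<bar>f x * indicator (cbox a b) x\<bar>)"
      using ind by (rule integrable_abs)
    show "AE x in lebesgue_on \<Omega>. norm (f x * box_bump a b n x) \<le> \<bar>f x * indicator (cbox a b) x\<bar>" for n
    proof (intro AE_I2)
      fix x
      have "box_bump a b n x = 0" if "x \<notin> cbox a b"
        using that by (rule box_bump_outside)
      then have "box_bump a b n x \<le> indicator (cbox a b) x"
        using box_bump_bounds[of a b n x] by (cases "x \<in> cbox a b") auto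
      then show "norm (f x * box_bump a b n x) \<le> \<bar>f x * indicator (cbox a b) x\<bar>"
        using box_bump_bounds[of a b n x] by (simp add: abs_mult mult_left_mono del: of_bool_eq)
    qed
  qed (use meas lim in auto)
  moreover have "(\<integral>x. f x * box_bump a b n x \<partial>lebesgue_on \<Omega>) = 0" for n
    by (rule orth[OF test_function_box_bump[OF box]])
  ultimately show ?thesis
    by (simp add: LIMSEQ_const_iff)
qed

text \<open>
  The integral of \<open>f\<close> over every box in \<open>\<Omega>\<close> vanishes, and by Lebesgue's differentiation theorem \<open>f\<close> is almost
  everywhere the limit of its averages over shrinking cubes.
\<close>

lemma AE_eq_0_if_orthogonal_test_functions:
  fixes f :: "'a::euclidean_space \<Rightarrow> real"
  assumes op: "open \<Omega>" and f: "f \<in> Lp (lebesgue_on \<Omega>) 2"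
    and orth: "\<And>\<phi>. test_function \<Omega> \<phi> \<Longrightarrow> (\<integral>x. f x * \<phi> x \<partial>lebesgue_on \<Omega>) = 0"
  shows "AE x in lebesgue_on \<Omega>. f x = 0"
proof -
  have \<Omega>: "\<Omega> \<in> sets lebesgue" using op by (simp add: borel_open)
  define f0 where "f0 = (\<lambda>x. indicator \<Omega> x * f x)"
  have f0_int: "integrable (lebesgue_on (cbox a b)) f0" for a b
  proof -
    have "integrable lebesgue (\<lambda>x. indicator \<Omega> x *\<^sub>R (f x * indicator (cbox a b) x))"
      using integrable_times_Lp_2[OF f indicator_cbox_Lp_2[OF \<Omega>]] \<Omega>
      by (simp add: integrable_restrict_space del: real_scaleR_def)
    also have "(\<lambda>x. indicator \<Omega> x *\<^sub>R (f x * indicator (cbox a b) x)) = (\<lambda>x. indicator (cbox a b) x *\<^sub>R f0 x)"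
      by (simp add: f0_def mult_ac)
    finally show ?thesis by (simp add: integrable_restrict_space)
  qed
  have f0_zero: "integral (cbox a b) f0 = 0" if "cbox a b \<subseteq> \<Omega>" for a b
  proof -
    have ib: "integrable (lebesgue_on (box a b)) f0"
    proof -
      have "integrable lebesgue (\<lambda>x. indicator (box a b) x *\<^sub>R (indicator (cbox a b) x *\<^sub>R f0 x))"
        by (rule integrable_mult_indicator) (use f0_int in \<open>simp_all add: integrable_restrict_space\<close>)
      also have "(\<lambda>x. indicator (box a b) x *\<^sub>R (indicator (cbox a b) x *\<^sub>R f0 x))
          = (\<lambda>x. indicator (box a b) x *\<^sub>R f0 x)"
        using box_subset_cbox[of a b] by (auto simp: indicator_def fun_eq_iff)
      finally show ?thesis by (simp add: integrable_restrict_space)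
    qed
    have "integral (cbox a b) f0 = integral (box a b) f0"
      by (rule integral_open_interval[symmetric])
    also have "\<dots> = (\<integral>x. f0 x \<partial>lebesgue_on (box a b))"
      by (rule lebesgue_integral_eq_integral[symmetric, OF ib]) simp
    also have "\<dots> = (\<integral>x. indicator (box a b) x *\<^sub>R f0 x \<partial>lebesgue)"
      by (rule integral_restrict_space) simp
    also have "(\<lambda>x. indicator (box a b) x *\<^sub>R f0 x) = (\<lambda>x. indicator \<Omega> x *\<^sub>R (f x * indicator (box a b) x))"
      by (simp add: f0_def mult_ac)
    also have "(\<integral>x. indicator \<Omega> x *\<^sub>R (f x * indicator (box a b) x) \<partial>lebesgue)
        = (\<integral>x. f x * indicator (box a b) x \<partial>lebesgue_on \<Omega>)"
      using \<Omega> by (intro integral_restrict_space[symmetric]) simp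
    also have "\<dots> = 0" by (rule integral_box_eq_0[OF \<Omega> f orth that])
    finally show ?thesis .
  qed
  obtain N where N: "negligible N" "\<And>x e. \<lbrakk>x \<notin> N; 0 < e\<rbrakk> \<Longrightarrow>
      \<exists>d>0. \<forall>h. 0 < h \<and> h < d \<longrightarrow> norm (integral (cbox x (x + h *\<^sub>R One)) f0 /\<^sub>R h ^ DIM('a) - f0 x) < e"
    by (rule integrable_ccontinuous_explicit[of f0])
      (use integrable_on_lebesgue_on[OF f0_int] in auto)
  have "f x = 0" if x: "x \<in> \<Omega>" "x \<notin> N" for x
  proof (rule ccontr)
    assume "f x \<noteq> 0"
    then have "0 < norm (f0 x)" using x by (simp add: f0_def)
    from N(2)[OF x(2) this] obtain d where d: "d > 0"
      "\<And>h. 0 < h \<Longrightarrow> h < d \<Longrightarrow> norm (integral (cbox x (x + h *\<^sub>R One)) f0 /\<^sub>R h ^ DIM('a) - f0 x) < norm (f0 x)"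
      by blast
    obtain r where r: "r > 0" "cball x r \<subseteq> \<Omega>"
      using op x(1) open_contains_cball by blast
    \<comment> \<open>A cube of side \<open>h\<close> with corner \<open>x\<close> has \<open>1\<close>-norm radius \<open>h DIM\<close>, so it stays in the ball of radius \<open>r\<close>.\<close>
    define h where "h = min (d / 2) (r / DIM('a))"
    have h: "0 < h" "h < d" "h * DIM('a) \<le> r"
      using d(1) r(1) by (auto simp: h_def min_def field_simps)
    have "cbox x (x + h *\<^sub>R One) \<subseteq> cball x r"
    proof
      fix y assume y: "y \<in> cbox x (x + h *\<^sub>R One)"
      have "norm (y - x) \<le> (\<Sum>i\<in>Basis. \<bar>(y - x) \<bullet> i\<bar>)" by (rule norm_le_l1)
      also have "\<dots> \<le> (\<Sum>i\<in>(Basis :: 'a set). h)"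
        using y by (intro sum_mono) (auto simp: mem_box inner_diff_left inner_add_left)
      also have "\<dots> \<le> r" using h(3) by (simp add: mult.commute)
      finally show "y \<in> cball x r" by (simp add: dist_norm norm_minus_commute)
    qed
    then have "integral (cbox x (x + h *\<^sub>R One)) f0 = 0"
      using r(2) by (intro f0_zero) blast
    with d(2)[OF h(1,2)] show False by simp
  qed
  moreover have "AE x in lebesgue. x \<notin> N"
    using N(1) by (simp add: AE_not_in negligible_iff_null_sets)
  ultimately have "AE x in lebesgue. x \<in> \<Omega> \<longrightarrow> f x = 0" by auto
  then show ?thesis using \<Omega> by (simp add: AE_restrict_space_iff)
qed

section \<open>Weak derivatives\<close>

text \<open>
  A scalar form of weak gradients, one direction at a time.  On a product the directions \<open>(b, 0)\<close> and \<open>(0, b)\<close> are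
  handled by different integrations, which the vector-valued notion cannot separate.
\<close>

definition weak_partial ::
    "'a::euclidean_space set \<Rightarrow> 'a \<Rightarrow> ('a \<Rightarrow> real) \<Rightarrow> ('a \<Rightarrow> real) \<Rightarrow> bool" where
  "weak_partial \<Omega> b u v \<longleftrightarrow> (\<forall>\<phi>. test_function \<Omega> \<phi> \<longrightarrow>
     (\<integral>x. u x * frechet_derivative \<phi> (at x) b \<partial>lebesgue_on \<Omega>) = - (\<integral>x. v x * \<phi> x \<partial>lebesgue_on \<Omega>))"

lemma weak_partialD:
  "weak_partial \<Omega> b u v \<Longrightarrow> test_function \<Omega> \<phi> \<Longrightarrow>
    (\<integral>x. u x * frechet_derivative \<phi> (at x) b \<partial>lebesgue_on \<Omega>) = - (\<integral>x. v x * \<phi> x \<partial>lebesgue_on \<Omega>)"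
  by (simp add: weak_partial_def)

lemma is_weak_gradient_iff_weak_partial:
  "is_weak_gradient \<Omega> u G \<longleftrightarrow> (\<forall>b\<in>Basis. weak_partial \<Omega> b u (\<lambda>x. G x \<bullet> b))"
  by (auto simp: is_weak_gradient_def weak_partial_def)

lemma weak_partial_unique:
  assumes op: "open \<Omega>" and v: "v \<in> Lp (lebesgue_on \<Omega>) 2" "w \<in> Lp (lebesgue_on \<Omega>) 2"
    and p: "weak_partial \<Omega> b u v" "weak_partial \<Omega> b u w"
  shows "AE x in lebesgue_on \<Omega>. v x = w x"
proof -
  have \<Omega>: "\<Omega> \<in> sets lebesgue" using op by (simp add: borel_open)
  have "AE x in lebesgue_on \<Omega>. v x + - w x = 0"
  proof (rule AE_eq_0_if_orthogonal_test_functions[OF op Lp_2_add[OF v(1) Lp_2_minus[OF v(2)]]])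
    fix \<phi> assume \<phi>: "test_function \<Omega> \<phi>"
    have "integrable (lebesgue_on \<Omega>) (\<lambda>x. v x * \<phi> x)" "integrable (lebesgue_on \<Omega>) (\<lambda>x. w x * \<phi> x)"
      by (intro integrable_times_Lp_2 v test_function_Lp_2[OF \<phi> \<Omega>])+
    then show "(\<integral>x. (v x + - w x) * \<phi> x \<partial>lebesgue_on \<Omega>) = 0"
      using weak_partialD[OF p(1) \<phi>] weak_partialD[OF p(2) \<phi>] by (simp add: left_diff_distrib)
  qed
  then show ?thesis by eventually_elim simp
qed

lemma weak_gradient_unique:
  assumes op: "open \<Omega>" and G: "G \<in> Lp (lebesgue_on \<Omega>) 2" "H \<in> Lp (lebesgue_on \<Omega>) 2"
    and g: "is_weak_gradient \<Omega> u G" "is_weak_gradient \<Omega> u H"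
  shows "AE x in lebesgue_on \<Omega>. G x = H x"
proof -
  have "AE x in lebesgue_on \<Omega>. \<forall>b\<in>Basis. G x \<bullet> b = H x \<bullet> b"
  proof (rule AE_finite_allI[OF finite_Basis])
    fix b :: 'a assume b: "b \<in> Basis"
    show "AE x in lebesgue_on \<Omega>. G x \<bullet> b = H x \<bullet> b"
      by (rule weak_partial_unique[where b = b and u = u, OF op Lp_2_component[OF G(1) b] Lp_2_component[OF G(2) b]])
        (use g b in \<open>simp_all add: is_weak_gradient_iff_weak_partial\<close>)
  qed
  then show ?thesis by eventually_elim (blast intro: euclidean_eqI)
qed

lemma wgrad_H1:
  assumes "u \<in> H1 \<Omega>"
  shows "wgrad \<Omega> u \<in> Lp (lebesgue_on \<Omega>) 2" "is_weak_gradient \<Omega> u (wgrad \<Omega> u)"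
proof -
  have "\<exists>G. G \<in> Lp (lebesgue_on \<Omega>) 2 \<and> is_weak_gradient \<Omega> u G"
    using assms by (auto simp: H1_def)
  from someI_ex[OF this]
  show "wgrad \<Omega> u \<in> Lp (lebesgue_on \<Omega>) 2" "is_weak_gradient \<Omega> u (wgrad \<Omega> u)"
    by (simp_all add: wgrad_def)
qed

lemma H1_Lp_2: "u \<in> H1 \<Omega> \<Longrightarrow> u \<in> Lp (lebesgue_on \<Omega>) 2"
  by (simp add: H1_def)

lemma H1_I:
  "u \<in> Lp (lebesgue_on \<Omega>) 2 \<Longrightarrow> G \<in> Lp (lebesgue_on \<Omega>) 2 \<Longrightarrow> is_weak_gradient \<Omega> u G \<Longrightarrow> u \<in> H1 \<Omega>"
  by (auto simp: H1_def)

text \<open>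
  This replaces the gradient chosen by \<open>wgrad\<close> with an explicit one under an integral.
\<close>

lemma AE_wgrad_eq:
  assumes "open \<Omega>" "u \<in> Lp (lebesgue_on \<Omega>) 2" "G \<in> Lp (lebesgue_on \<Omega>) 2" "is_weak_gradient \<Omega> u G"
  shows "AE x in lebesgue_on \<Omega>. wgrad \<Omega> u x = G x"
  using wgrad_H1[OF H1_I[OF assms(2-)]] assms weak_gradient_unique by blast

lemma wgrad_partial:
  assumes "u \<in> H1 \<Omega>" "b \<in> Basis"
  shows "weak_partial \<Omega> b u (\<lambda>x. wgrad \<Omega> u x \<bullet> b)"
  using wgrad_H1(2)[OF assms(1)] assms(2) by (simp add: is_weak_gradient_iff_weak_partial)

lemma open_lebesgue_product: "open A \<Longrightarrow> open B \<Longrightarrow> lebesgue_product A B"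
  by (simp add: lebesgue_product_def borel_open)

lemma weak_partial_swap:
  fixes A :: "'a::euclidean_space set" and B :: "'b::euclidean_space set"
  assumes "lebesgue_product A B" and b: "b \<in> Basis"
    and u: "u \<in> Lp (lebesgue_on (A \<times> B)) 2" and v: "v \<in> Lp (lebesgue_on (A \<times> B)) 2"
    and p: "weak_partial (A \<times> B) b u v"
  shows "weak_partial (B \<times> A) (prod.swap b) (\<lambda>z. u (prod.swap z)) (\<lambda>z. v (prod.swap z))"
  unfolding weak_partial_def
proof (intro allI impI)
  interpret lebesgue_product A B by fact
  fix \<phi> assume \<phi>: "test_function (B \<times> A) \<phi>"
  note \<phi>s = test_function_swap[OF \<phi>]
  have "(\<integral>z. u (prod.swap z) * frechet_derivative \<phi> (at z) (prod.swap b) \<partial>lebesgue_on (B \<times> A))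
      = (\<integral>z. u (prod.swap z) * frechet_derivative (\<lambda>w. \<phi> (prod.swap w)) (at (prod.swap z)) b \<partial>lebesgue_on (B \<times> A))"
    by (simp add: \<phi>s(2))
  also have "\<dots> = (\<integral>z. u z * frechet_derivative (\<lambda>w. \<phi> (prod.swap w)) (at z) b \<partial>lebesgue_on (A \<times> B))"
    by (rule integral_swap(2)[of "\<lambda>z. u z * frechet_derivative (\<lambda>w. \<phi> (prod.swap w)) (at z) b"])
      (intro borel_measurable_times Lp_2_measurable u test_function_Lp_2 test_function_partial \<phi>s(1) b Times_sets_lebesgue)
  also have "\<dots> = - (\<integral>z. v z * \<phi> (prod.swap z) \<partial>lebesgue_on (A \<times> B))"
    by (rule weak_partialD[OF p \<phi>s(1)])
  also have "(\<integral>z. v z * \<phi> (prod.swap z) \<partial>lebesgue_on (A \<times> B))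
      = (\<integral>z. v (prod.swap z) * \<phi> (prod.swap (prod.swap z)) \<partial>lebesgue_on (B \<times> A))"
    by (rule integral_swap(2)[of "\<lambda>z. v z * \<phi> (prod.swap z)", symmetric])
      (intro borel_measurable_times Lp_2_measurable v test_function_Lp_2 \<phi>s(1) Times_sets_lebesgue)
  finally show "(\<integral>z. u (prod.swap z) * frechet_derivative \<phi> (at z) (prod.swap b) \<partial>lebesgue_on (B \<times> A))
      = - (\<integral>z. v (prod.swap z) * \<phi> z \<partial>lebesgue_on (B \<times> A))" by simp
qed

context lebesgue_product
begin

lemma integral_iterated_swapped:
  fixes K :: "'a \<times> 'b \<Rightarrow> real"
  assumes K: "integrable (lebesgue_on (A \<times> B)) K"
  shows "integral\<^sup>L (lebesgue_on (A \<times> B)) K = (\<integral>y. \<integral>x. K (x, y) \<partial>lebesgue_on A \<partial>lebesgue_on B)"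
proof -
  interpret s: lebesgue_product B A
    using lebesgue_product_axioms by (rule lebesgue_product_swap)
  note m = borel_measurable_integrable[OF K]
  have "integrable (lebesgue_on (B \<times> A)) (\<lambda>z. K (prod.swap z))"
    using K integral_swap(1)[OF m] by simp
  from s.integral_iterated[OF this] integral_swap(2)[OF m] show ?thesis by simp
qed

text \<open>
  For fixed \<open>y\<close> the slice of a test function is a test function on \<open>A\<close>, so the weak derivative of \<open>f\<close> is applied in
  the inner integral, with \<open>y\<close> integrated last.
\<close>

lemma weak_partial_tensor:
  assumes f: "f \<in> Lp (lebesgue_on A) 2" and v: "v \<in> Lp (lebesgue_on A) 2"
    and p: "weak_partial A b f v" and b: "b \<in> Basis"
    and g: "g \<in> Lp (lebesgue_on B) 2"
  shows "weak_partial (A \<times> B) (b, 0) (\<lambda>z. f (fst z) * g (snd z)) (\<lambda>z. v (fst z) * g (snd z))"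
  unfolding weak_partial_def
proof (intro allI impI)
  fix \<phi> :: "'a \<times> 'b \<Rightarrow> real" assume \<phi>: "test_function (A \<times> B) \<phi>"
  have b': "(b, 0) \<in> (Basis :: ('a \<times> 'b) set)" using b by (auto simp: Basis_prod_def)
  have i: "integrable (lebesgue_on (A \<times> B)) (\<lambda>z. f (fst z) * g (snd z) * frechet_derivative \<phi> (at z) (b, 0))"
    "integrable (lebesgue_on (A \<times> B)) (\<lambda>z. v (fst z) * g (snd z) * \<phi> z)"
    by (intro integrable_times_Lp_2 Lp_2_tensor f g v test_function_Lp_2 test_function_partial \<phi> b' Times_sets_lebesgue)+
  have "(\<integral>z. f (fst z) * g (snd z) * frechet_derivative \<phi> (at z) (b, 0) \<partial>lebesgue_on (A \<times> B))
      = (\<integral>y. \<integral>x. g y * (f x * frechet_derivative (\<lambda>x. \<phi> (x, y)) (at x) b) \<partial>lebesgue_on A \<partial>lebesgue_on B)"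
    unfolding integral_iterated_swapped[OF i(1)] test_function_slice(2)[OF \<phi>] by (simp add: mult_ac)
  also have "\<dots> = (\<integral>y. g y * - (\<integral>x. v x * \<phi> (x, y) \<partial>lebesgue_on A) \<partial>lebesgue_on B)"
    unfolding integral_mult_right_zero weak_partialD[OF p test_function_slice(1)[OF \<phi>]] ..
  also have "\<dots> = - (\<integral>y. \<integral>x. g y * (v x * \<phi> (x, y)) \<partial>lebesgue_on A \<partial>lebesgue_on B)"
    by simp
  also have "(\<integral>y. \<integral>x. g y * (v x * \<phi> (x, y)) \<partial>lebesgue_on A \<partial>lebesgue_on B)
      = (\<integral>z. v (fst z) * g (snd z) * \<phi> z \<partial>lebesgue_on (A \<times> B))"
    unfolding integral_iterated_swapped[OF i(2)] by (simp add: mult_ac)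
  finally show "(\<integral>z. f (fst z) * g (snd z) * frechet_derivative \<phi> (at z) (b, 0) \<partial>lebesgue_on (A \<times> B))
      = - (\<integral>z. v (fst z) * g (snd z) * \<phi> z \<partial>lebesgue_on (A \<times> B))" .
qed

lemma integral_partial_integral:
  fixes K :: "'a \<times> 'b \<Rightarrow> real"
  assumes K: "K \<in> Lp (lebesgue_on (A \<times> B)) 2" and f: "f \<in> Lp (lebesgue_on A) 2"
    and g: "g \<in> Lp (lebesgue_on B) 2"
  shows "(\<integral>x. f x * (\<integral>y. g y * K (x, y) \<partial>lebesgue_on B) \<partial>lebesgue_on A)
    = (\<integral>z. f (fst z) * g (snd z) * K z \<partial>lebesgue_on (A \<times> B))"
  using integral_iterated[OF integrable_times_Lp_2[OF Lp_2_tensor[OF f g] K]]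
  by (simp add: mult.assoc)

text \<open>
  Fix a test function \<open>\<phi>\<close> on \<open>A\<close>.  The claim is \<open>\<integral> W g = 0\<close>, where \<open>W(y)\<close> is the defect of the integration-by-parts
  formula for \<open>\<phi>\<close> on the slice of \<open>h\<close> at \<open>y\<close>.  For a test function \<open>\<psi>\<close> in place of \<open>g\<close> this is the weak derivative of
  \<open>h\<close> tested with \<open>\<phi>(x) \<psi>(y)\<close>; hence \<open>W = 0\<close> almost everywhere, and the claim holds for every square-integrable \<open>g\<close>.
\<close>

lemma weak_partial_partial_integral:
  fixes h D :: "'a \<times> 'b \<Rightarrow> real"
  assumes opB: "open B"
    and h: "h \<in> Lp (lebesgue_on (A \<times> B)) 2" and D: "D \<in> Lp (lebesgue_on (A \<times> B)) 2"
    and p: "weak_partial (A \<times> B) (b, 0) h D" and b: "b \<in> Basis"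
    and g: "g \<in> Lp (lebesgue_on B) 2"
  shows "weak_partial A b (\<lambda>x. \<integral>y. g y * h (x, y) \<partial>lebesgue_on B) (\<lambda>x. \<integral>y. g y * D (x, y) \<partial>lebesgue_on B)"
  unfolding weak_partial_def
proof (intro allI impI)
  interpret s: lebesgue_product B A
    using lebesgue_product_axioms by (rule lebesgue_product_swap)
  fix \<phi> assume \<phi>: "test_function A \<phi>"
  define d where "d x = frechet_derivative \<phi> (at x) b" for x
  have \<phi>2: "\<phi> \<in> Lp (lebesgue_on A) 2" and d2: "d \<in> Lp (lebesgue_on A) 2"
    unfolding d_def[abs_def] by (intro test_function_Lp_2 test_function_partial \<phi> b A)+
  define W where "W y = (\<integral>x. d x * h (x, y) \<partial>lebesgue_on A) + (\<integral>x. \<phi> x * D (x, y) \<partial>lebesgue_on A)" for y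
  have W1: "(\<lambda>y. \<integral>x. d x * h (x, y) \<partial>lebesgue_on A) \<in> Lp (lebesgue_on B) 2"
    using s.Lp_2_partial_integral[OF Lp_2_swap[OF h] d2] by simp
  have W2: "(\<lambda>y. \<integral>x. \<phi> x * D (x, y) \<partial>lebesgue_on A) \<in> Lp (lebesgue_on B) 2"
    using s.Lp_2_partial_integral[OF Lp_2_swap[OF D] \<phi>2] by simp
  have W: "W \<in> Lp (lebesgue_on B) 2"
    unfolding W_def[abs_def] by (rule Lp_2_add[OF W1 W2])
  have pair: "(\<integral>y. W y * \<psi> y \<partial>lebesgue_on B)
      = (\<integral>x. d x * (\<integral>y. \<psi> y * h (x, y) \<partial>lebesgue_on B) \<partial>lebesgue_on A)
      + (\<integral>x. \<phi> x * (\<integral>y. \<psi> y * D (x, y) \<partial>lebesgue_on B) \<partial>lebesgue_on A)"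
    if \<psi>: "\<psi> \<in> Lp (lebesgue_on B) 2" for \<psi>
  proof -
    have exch: "(\<integral>y. \<psi> y * (\<integral>x. e x * K (x, y) \<partial>lebesgue_on A) \<partial>lebesgue_on B)
        = (\<integral>x. e x * (\<integral>y. \<psi> y * K (x, y) \<partial>lebesgue_on B) \<partial>lebesgue_on A)"
      if e: "e \<in> Lp (lebesgue_on A) 2" and K: "K \<in> Lp (lebesgue_on (A \<times> B)) 2" for e K
    proof -
      have "\<psi> y * (\<integral>x. e x * K (x, y) \<partial>lebesgue_on A) = (\<integral>x. e x * \<psi> y * K (x, y) \<partial>lebesgue_on A)" for y
        unfolding integral_mult_right_zero[symmetric] by (simp add: mult_ac)
      then show ?thesis
        using integral_partial_integral[OF K e \<psi>]
          integral_iterated_swapped[OF integrable_times_Lp_2[OF Lp_2_tensor[OF e \<psi>] K]]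
        by simp
    qed
    have "(\<integral>y. W y * \<psi> y \<partial>lebesgue_on B)
        = (\<integral>y. \<psi> y * (\<integral>x. d x * h (x, y) \<partial>lebesgue_on A) + \<psi> y * (\<integral>x. \<phi> x * D (x, y) \<partial>lebesgue_on A) \<partial>lebesgue_on B)"
      by (simp add: W_def algebra_simps)
    also have "\<dots> = (\<integral>y. \<psi> y * (\<integral>x. d x * h (x, y) \<partial>lebesgue_on A) \<partial>lebesgue_on B)
        + (\<integral>y. \<psi> y * (\<integral>x. \<phi> x * D (x, y) \<partial>lebesgue_on A) \<partial>lebesgue_on B)"
      by (intro Bochner_Integration.integral_add integrable_times_Lp_2 \<psi> W1 W2)
    finally show ?thesis unfolding exch[OF d2 h] exch[OF \<phi>2 D] .
  qed
  have "AE y in lebesgue_on B. W y = 0"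
  proof (rule AE_eq_0_if_orthogonal_test_functions[OF opB W])
    fix \<psi> assume \<psi>: "test_function B \<psi>"
    have \<psi>2: "\<psi> \<in> Lp (lebesgue_on B) 2" by (rule test_function_Lp_2[OF \<psi> B])
    have "(\<integral>z. d (fst z) * \<psi> (snd z) * h z \<partial>lebesgue_on (A \<times> B))
        = - (\<integral>z. \<phi> (fst z) * \<psi> (snd z) * D z \<partial>lebesgue_on (A \<times> B))"
      using weak_partialD[OF p test_function_tensor[OF \<phi> \<psi>]]
      unfolding frechet_derivative_tensor_fst[OF \<phi> \<psi>] d_def by (simp add: mult_ac)
    then show "(\<integral>y. W y * \<psi> y \<partial>lebesgue_on B) = 0"
      unfolding pair[OF \<psi>2] integral_partial_integral[OF h d2 \<psi>2] integral_partial_integral[OF D \<phi>2 \<psi>2]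
      by simp
  qed
  then have "(\<integral>y. W y * g y \<partial>lebesgue_on B) = (\<integral>y. 0 \<partial>lebesgue_on B)"
    using Lp_2_measurable[OF W] Lp_2_measurable[OF g] by (intro integral_cong_AE) auto
  then show "(\<integral>x. (\<integral>y. g y * h (x, y) \<partial>lebesgue_on B) * frechet_derivative \<phi> (at x) b \<partial>lebesgue_on A)
      = - (\<integral>x. (\<integral>y. g y * D (x, y) \<partial>lebesgue_on B) * \<phi> x \<partial>lebesgue_on A)"
    unfolding pair[OF g] d_def by (simp add: mult.commute)
qed

end

section \<open>Neumann eigenfunctions on products\<close>

lemma neumann_eigenspaceD:
  assumes "u \<in> neumann_eigenspace \<Omega> \<mu>"
  shows "u \<in> H1 \<Omega>"
    and "h \<in> H1 \<Omega> \<Longrightarrow> (\<integral>x. wgrad \<Omega> u x \<bullet> wgrad \<Omega> h x \<partial>lebesgue_on \<Omega>)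
      = \<mu> * (\<integral>x. u x * h x \<partial>lebesgue_on \<Omega>)"
  using assms by (auto simp: neumann_eigenspace_def)

text \<open>
  This identity turns orthogonality in \<open>H\<^sup>1\<close> into orthogonality in \<open>L\<^sup>2\<close> and back.
\<close>

lemma H1_inner_eigenspace:
  assumes u: "u \<in> neumann_eigenspace \<Omega> \<mu>" and h: "h \<in> H1 \<Omega>"
  shows "H1_inner \<Omega> u h = (1 + \<mu>) * L2_inner \<Omega> u h"
proof -
  have "H1_inner \<Omega> u h = (\<integral>x. u x * h x \<partial>lebesgue_on \<Omega>) + (\<integral>x. wgrad \<Omega> u x \<bullet> wgrad \<Omega> h x \<partial>lebesgue_on \<Omega>)"
    unfolding H1_inner_def
    by (intro Bochner_Integration.integral_add integrable_times_Lp_2 integrable_inner_Lp_2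
        H1_Lp_2 wgrad_H1 h neumann_eigenspaceD(1)[OF u])
  then show ?thesis
    by (simp add: neumann_eigenspaceD(2)[OF u h] L2_inner_def algebra_simps)
qed

context lebesgue_product
begin

text \<open>
  The contribution of the first factor to the Dirichlet form of a tensor product: Fubini's theorem turns it into
  the Dirichlet form of \<open>f\<close> and the average \<open>\<integral> g(y) h(x, y) dy\<close>, to which the eigenvalue equation of \<open>f\<close> applies.
\<close>

lemma eigenspace_tensor_fst:
  fixes h :: "'a \<times> 'b \<Rightarrow> real" and D :: "'a \<times> 'b \<Rightarrow> 'a"
  assumes op: "open A" "open B"
    and f: "f \<in> neumann_eigenspace A \<mu>" and g: "g \<in> Lp (lebesgue_on B) 2"
    and h: "h \<in> Lp (lebesgue_on (A \<times> B)) 2" and D: "D \<in> Lp (lebesgue_on (A \<times> B)) 2"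
    and p: "\<And>b. b \<in> Basis \<Longrightarrow> weak_partial (A \<times> B) (b, 0) h (\<lambda>z. D z \<bullet> b)"
  shows "(\<integral>z. g (snd z) * (wgrad A f (fst z) \<bullet> D z) \<partial>lebesgue_on (A \<times> B))
    = \<mu> * (\<integral>z. f (fst z) * g (snd z) * h z \<partial>lebesgue_on (A \<times> B))"
proof -
  define H where "H x = (\<integral>y. g y * h (x, y) \<partial>lebesgue_on B)" for x
  \<comment> \<open>The weak gradient of \<open>H\<close>, assembled from its components because slices have been integrated only for real functions.\<close>
  define E where "E x = (\<Sum>b\<in>Basis. (\<integral>y. g y * (D (x, y) \<bullet> b) \<partial>lebesgue_on B) *\<^sub>R b)" for x
  note F = wgrad_H1[OF neumann_eigenspaceD(1)[OF f]]
  have Hl: "H \<in> Lp (lebesgue_on A) 2"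
    unfolding H_def[abs_def] by (rule Lp_2_partial_integral[OF h g])
  have Eb: "E x \<bullet> b = (\<integral>y. g y * (D (x, y) \<bullet> b) \<partial>lebesgue_on B)" if "b \<in> Basis" for x b
    using that by (simp add: E_def)
  have El: "E \<in> Lp (lebesgue_on A) 2"
  proof (rule Lp_2_componentwise)
    fix b :: 'a assume b: "b \<in> Basis"
    show "(\<lambda>x. E x \<bullet> b) \<in> Lp (lebesgue_on A) 2"
      unfolding Eb[OF b] by (rule Lp_2_partial_integral[OF Lp_2_component[OF D b] g])
  qed
  have wE: "is_weak_gradient A H E"
    unfolding is_weak_gradient_iff_weak_partial
  proof
    fix b :: 'a assume b: "b \<in> Basis"
    show "weak_partial A b H (\<lambda>x. E x \<bullet> b)"
      unfolding Eb[OF b] H_def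
      by (rule weak_partial_partial_integral[OF op(2) h Lp_2_component[OF D b] p[OF b] b g])
  qed
  have "(\<integral>z. g (snd z) * (wgrad A f (fst z) \<bullet> D z) \<partial>lebesgue_on (A \<times> B))
      = (\<integral>z. (\<Sum>b\<in>Basis. (wgrad A f (fst z) \<bullet> b) * g (snd z) * (D z \<bullet> b)) \<partial>lebesgue_on (A \<times> B))"
    by (subst euclidean_inner) (simp add: sum_distrib_left mult_ac)
  also have "\<dots> = (\<Sum>b\<in>Basis. \<integral>z. (wgrad A f (fst z) \<bullet> b) * g (snd z) * (D z \<bullet> b) \<partial>lebesgue_on (A \<times> B))"
    by (intro Bochner_Integration.integral_sum integrable_times_Lp_2 Lp_2_tensor[of "\<lambda>x. wgrad A f x \<bullet> b" for b]
        Lp_2_component F(1) D g)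
  also have "\<dots> = (\<Sum>b\<in>Basis. \<integral>x. (wgrad A f x \<bullet> b) * (E x \<bullet> b) \<partial>lebesgue_on A)"
    by (intro sum.cong refl) (simp add: Eb integral_partial_integral[OF Lp_2_component[OF D] Lp_2_component[OF F(1)] g])
  also have "\<dots> = (\<integral>x. (\<Sum>b\<in>Basis. (wgrad A f x \<bullet> b) * (E x \<bullet> b)) \<partial>lebesgue_on A)"
    by (intro Bochner_Integration.integral_sum[symmetric] integrable_times_Lp_2 Lp_2_component F(1) El)
  also have "\<dots> = (\<integral>x. wgrad A f x \<bullet> E x \<partial>lebesgue_on A)"
    by (subst (2) euclidean_inner) simp
  also have "\<dots> = (\<integral>x. wgrad A f x \<bullet> wgrad A H x \<partial>lebesgue_on A)"
  proof (rule integral_cong_AE)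
    show "AE x in lebesgue_on A. wgrad A f x \<bullet> E x = wgrad A f x \<bullet> wgrad A H x"
      using AE_wgrad_eq[OF op(1) Hl El wE] by eventually_elim simp
    show "(\<lambda>x. wgrad A f x \<bullet> E x) \<in> borel_measurable (lebesgue_on A)"
      "(\<lambda>x. wgrad A f x \<bullet> wgrad A H x) \<in> borel_measurable (lebesgue_on A)"
      by (intro borel_measurable_inner Lp_2_measurable F(1) El wgrad_H1(1)[OF H1_I[OF Hl El wE]])+
  qed
  also have "\<dots> = \<mu> * (\<integral>x. f x * H x \<partial>lebesgue_on A)"
    by (rule neumann_eigenspaceD(2)[OF f H1_I[OF Hl El wE]])
  also have "(\<integral>x. f x * H x \<partial>lebesgue_on A) = (\<integral>z. f (fst z) * g (snd z) * h z \<partial>lebesgue_on (A \<times> B))"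
    unfolding H_def by (rule integral_partial_integral[OF h H1_Lp_2[OF neumann_eigenspaceD(1)[OF f]] g])
  finally show ?thesis .
qed

lemma eigenspace_tensor_snd:
  fixes h :: "'a \<times> 'b \<Rightarrow> real" and D :: "'a \<times> 'b \<Rightarrow> 'b"
  assumes op: "open A" "open B"
    and f: "f \<in> Lp (lebesgue_on A) 2" and g: "g \<in> neumann_eigenspace B \<nu>"
    and h: "h \<in> Lp (lebesgue_on (A \<times> B)) 2" and D: "D \<in> Lp (lebesgue_on (A \<times> B)) 2"
    and p: "\<And>b. b \<in> Basis \<Longrightarrow> weak_partial (A \<times> B) (0, b) h (\<lambda>z. D z \<bullet> b)"
  shows "(\<integral>z. f (fst z) * (wgrad B g (snd z) \<bullet> D z) \<partial>lebesgue_on (A \<times> B))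
    = \<nu> * (\<integral>z. f (fst z) * g (snd z) * h z \<partial>lebesgue_on (A \<times> B))"
proof -
  interpret s: lebesgue_product B A
    using lebesgue_product_axioms by (rule lebesgue_product_swap)
  have Db: "(\<lambda>z. D z \<bullet> b) \<in> Lp (lebesgue_on (A \<times> B)) 2" if "b \<in> Basis" for b
    using D that by (rule Lp_2_component)
  have Ds: "(\<lambda>z. D (prod.swap z)) \<in> Lp (lebesgue_on (B \<times> A)) 2"
    by (rule Lp_2_componentwise) (rule Lp_2_swap[OF Db])
  have ps: "weak_partial (B \<times> A) (b, 0) (\<lambda>z. h (prod.swap z)) (\<lambda>z. D (prod.swap z) \<bullet> b)" if "b \<in> Basis" for b
    using weak_partial_swap[OF lebesgue_product_axioms _ h Db[OF that] p[OF that]] that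
    by (simp add: Basis_prod_def)
  have gm: "(\<lambda>z. f (fst z) * g (snd z)) \<in> Lp (lebesgue_on (A \<times> B)) 2"
    by (intro Lp_2_tensor f H1_Lp_2 neumann_eigenspaceD(1)[OF g])
  have "(\<lambda>z. f (fst z) * (wgrad B g (snd z) \<bullet> D z)) \<in> borel_measurable (lebesgue_on (A \<times> B))"
    by (rule borel_measurable_times[OF
        measurable_compose[OF fst_measurable_lebesgue_on Lp_2_measurable[OF f]]
        borel_measurable_inner[OF measurable_compose[OF snd_measurable_lebesgue_on
          Lp_2_measurable[OF wgrad_H1(1)[OF neumann_eigenspaceD(1)[OF g]]]] Lp_2_measurable[OF D]]])
  from integral_swap(2)[OF this]
    s.eigenspace_tensor_fst[OF op(2,1) g f Lp_2_swap[OF h] Ds ps]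
    integral_swap(2)[OF borel_measurable_times[OF Lp_2_measurable[OF gm] Lp_2_measurable[OF h]]]
  show ?thesis by (simp add: mult_ac)
qed

text \<open>
  The components in the directions of \<open>B\<close> are those of \<open>g \<otimes> f\<close> on \<open>B \<times> A\<close> in the directions of \<open>B\<close>, carried back by the
  exchange of factors.
\<close>

lemma weak_gradient_tensor:
  assumes f: "f \<in> H1 A" and g: "g \<in> H1 B"
  defines "G \<equiv> \<lambda>z. (g (snd z) *\<^sub>R wgrad A f (fst z), f (fst z) *\<^sub>R wgrad B g (snd z))"
  shows "G \<in> Lp (lebesgue_on (A \<times> B)) 2"
    and "is_weak_gradient (A \<times> B) (\<lambda>z. f (fst z) * g (snd z)) G"
proof -
  interpret s: lebesgue_product B A
    using lebesgue_product_axioms by (rule lebesgue_product_swap)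
  note f2 = H1_Lp_2[OF f] and g2 = H1_Lp_2[OF g]
  have fb: "(\<lambda>x. wgrad A f x \<bullet> b) \<in> Lp (lebesgue_on A) 2" if "b \<in> Basis" for b
    using wgrad_H1(1)[OF f] that by (rule Lp_2_component)
  have gb: "(\<lambda>x. wgrad B g x \<bullet> b) \<in> Lp (lebesgue_on B) 2" if "b \<in> Basis" for b
    using wgrad_H1(1)[OF g] that by (rule Lp_2_component)
  have *: "(\<lambda>z. G z \<bullet> c) \<in> Lp (lebesgue_on (A \<times> B)) 2 \<and>
      weak_partial (A \<times> B) c (\<lambda>z. f (fst z) * g (snd z)) (\<lambda>z. G z \<bullet> c)" if c: "c \<in> Basis" for c
  proof -
    consider b where "b \<in> Basis" "c = (b, 0)" | b where "b \<in> Basis" "c = (0, b)"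
      using c by (auto simp: Basis_prod_def)
    then show ?thesis
    proof cases
      case 1
      have "(\<lambda>z. G z \<bullet> c) = (\<lambda>z. (wgrad A f (fst z) \<bullet> b) * g (snd z))"
        by (simp add: G_def 1 mult.commute)
      then show ?thesis
        using Lp_2_tensor[OF fb[OF 1(1)] g2] weak_partial_tensor[OF f2 fb[OF 1(1)] wgrad_partial[OF f 1(1)] 1(1) g2] 1(2)
        by simp
    next
      case 2
      have "(\<lambda>z. G z \<bullet> c) = (\<lambda>z. f (fst z) * (wgrad B g (snd z) \<bullet> b))"
        by (simp add: G_def 2)
      moreover have "weak_partial (A \<times> B) (prod.swap (b, 0))
          (\<lambda>z. g (fst (prod.swap z)) * f (snd (prod.swap z)))
          (\<lambda>z. (wgrad B g (fst (prod.swap z)) \<bullet> b) * f (snd (prod.swap z)))"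
        by (rule weak_partial_swap[OF s.lebesgue_product_axioms _
            s.Lp_2_tensor[OF g2 f2] s.Lp_2_tensor[OF gb[OF 2(1)] f2]
            s.weak_partial_tensor[OF g2 gb[OF 2(1)] wgrad_partial[OF g 2(1)] 2(1) f2]])
          (use 2(1) in \<open>simp add: Basis_prod_def\<close>)
      ultimately show ?thesis
        using Lp_2_tensor[OF f2 gb[OF 2(1)]] 2(2) by (simp add: mult.commute)
    qed
  qed
  show "G \<in> Lp (lebesgue_on (A \<times> B)) 2"
    by (rule Lp_2_componentwise) (use * in blast)
  show "is_weak_gradient (A \<times> B) (\<lambda>z. f (fst z) * g (snd z)) G"
    using * unfolding is_weak_gradient_iff_weak_partial by blast
qed

lemma L2_inner_tensor:
  assumes "f \<in> Lp (lebesgue_on A) 2" "f' \<in> Lp (lebesgue_on A) 2"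
    and "g \<in> Lp (lebesgue_on B) 2" "g' \<in> Lp (lebesgue_on B) 2"
  shows "L2_inner (A \<times> B) (tensor f g) (tensor f' g') = L2_inner A f f' * L2_inner B g g'"
  using integral_tensor[OF integrable_times_Lp_2[OF assms(1,2)] integrable_times_Lp_2[OF assms(3,4)]]
  by (simp add: L2_inner_def tensor_def case_prod_beta' mult_ac)

text \<open>
  The two halves of the gradient contribute \<open>\<mu>\<close> and \<open>\<nu>\<close>.
\<close>

proposition tensor_eigenspace:
  assumes op: "open A" "open B"
    and f: "f \<in> neumann_eigenspace A \<mu>" and g: "g \<in> neumann_eigenspace B \<nu>"
  shows "tensor f g \<in> neumann_eigenspace (A \<times> B) (\<mu> + \<nu>)"
proof -
  note fH = neumann_eigenspaceD(1)[OF f] and gH = neumann_eigenspaceD(1)[OF g]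
  define G where "G = (\<lambda>z. (g (snd z) *\<^sub>R wgrad A f (fst z), f (fst z) *\<^sub>R wgrad B g (snd z)))"
  let ?u = "\<lambda>z. f (fst z) * g (snd z)"
  have u2: "?u \<in> Lp (lebesgue_on (A \<times> B)) 2"
    by (intro Lp_2_tensor H1_Lp_2 fH gH)
  have G2: "G \<in> Lp (lebesgue_on (A \<times> B)) 2" and Gw: "is_weak_gradient (A \<times> B) ?u G"
    unfolding G_def by (rule weak_gradient_tensor[OF fH gH])+
  have uH: "?u \<in> H1 (A \<times> B)" by (rule H1_I[OF u2 G2 Gw])
  have opAB: "open (A \<times> B)" using op by (rule open_Times)
  have "(\<integral>z. wgrad (A \<times> B) ?u z \<bullet> wgrad (A \<times> B) h z \<partial>lebesgue_on (A \<times> B))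
      = (\<mu> + \<nu>) * (\<integral>z. ?u z * h z \<partial>lebesgue_on (A \<times> B))" if h: "h \<in> H1 (A \<times> B)" for h
  proof -
    note h2 = H1_Lp_2[OF h]
    let ?D = "wgrad (A \<times> B) h"
    note D2 = wgrad_H1(1)[OF h]
    have b1: "(b, 0) \<in> (Basis :: ('a \<times> 'b) set)" if "b \<in> Basis" for b using that by (auto simp: Basis_prod_def)
    have b2: "(0, b) \<in> (Basis :: ('a \<times> 'b) set)" if "b \<in> Basis" for b using that by (auto simp: Basis_prod_def)
    have i1: "?D z \<bullet> (b, 0) = fst (?D z) \<bullet> b" and i2: "?D z \<bullet> (0, c) = snd (?D z) \<bullet> c" for z b c
      by (simp_all add: inner_prod_def)
    have D1: "(\<lambda>z. fst (?D z)) \<in> Lp (lebesgue_on (A \<times> B)) 2"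
      by (rule Lp_2_componentwise) (use Lp_2_component[OF D2 b1] in \<open>simp add: i1\<close>)
    have D3: "(\<lambda>z. snd (?D z)) \<in> Lp (lebesgue_on (A \<times> B)) 2"
      by (rule Lp_2_componentwise) (use Lp_2_component[OF D2 b2] in \<open>simp add: i2\<close>)
    have G1: "(\<lambda>z. fst (G z)) \<in> Lp (lebesgue_on (A \<times> B)) 2"
    proof (rule Lp_2_componentwise)
      fix b :: 'a assume "b \<in> Basis"
      from Lp_2_component[OF G2 b1[OF this]] show "(\<lambda>z. fst (G z) \<bullet> b) \<in> Lp (lebesgue_on (A \<times> B)) 2"
        by (simp add: inner_prod_def)
    qed
    have G3: "(\<lambda>z. snd (G z)) \<in> Lp (lebesgue_on (A \<times> B)) 2"
    proof (rule Lp_2_componentwise)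
      fix b :: 'b assume "b \<in> Basis"
      from Lp_2_component[OF G2 b2[OF this]] show "(\<lambda>z. snd (G z) \<bullet> b) \<in> Lp (lebesgue_on (A \<times> B)) 2"
        by (simp add: inner_prod_def)
    qed
    have "(\<integral>z. wgrad (A \<times> B) ?u z \<bullet> ?D z \<partial>lebesgue_on (A \<times> B)) = (\<integral>z. G z \<bullet> ?D z \<partial>lebesgue_on (A \<times> B))"
    proof (rule integral_cong_AE)
      show "AE z in lebesgue_on (A \<times> B). wgrad (A \<times> B) ?u z \<bullet> ?D z = G z \<bullet> ?D z"
        using AE_wgrad_eq[OF opAB u2 G2 Gw] by eventually_elim simp
    qed (intro borel_measurable_inner Lp_2_measurable G2 D2 wgrad_H1(1)[OF uH])+
    also have "\<dots> = (\<integral>z. fst (G z) \<bullet> fst (?D z) + snd (G z) \<bullet> snd (?D z) \<partial>lebesgue_on (A \<times> B))"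
      by (simp add: inner_prod_def)
    also have "\<dots> = (\<integral>z. fst (G z) \<bullet> fst (?D z) \<partial>lebesgue_on (A \<times> B))
        + (\<integral>z. snd (G z) \<bullet> snd (?D z) \<partial>lebesgue_on (A \<times> B))"
      by (intro Bochner_Integration.integral_add integrable_inner_Lp_2 G1 G3 D1 D3)
    also have "(\<integral>z. fst (G z) \<bullet> fst (?D z) \<partial>lebesgue_on (A \<times> B)) = \<mu> * (\<integral>z. ?u z * h z \<partial>lebesgue_on (A \<times> B))"
      using eigenspace_tensor_fst[OF op f H1_Lp_2[OF gH] h2 D1] wgrad_partial[OF h b1]
      by (simp add: G_def i1)
    also have "(\<integral>z. snd (G z) \<bullet> snd (?D z) \<partial>lebesgue_on (A \<times> B)) = \<nu> * (\<integral>z. ?u z * h z \<partial>lebesgue_on (A \<times> B))"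
      using eigenspace_tensor_snd[OF op H1_Lp_2[OF fH] g h2 D3] wgrad_partial[OF h b2]
      by (simp add: G_def i2)
    finally show ?thesis by (simp add: distrib_right)
  qed
  moreover have "tensor f g = ?u" by (auto simp: tensor_def)
  ultimately show ?thesis
    using uH by (simp add: neumann_eigenspace_def)
qed

end

text \<open>
  Here \<open>(1 + lam j) L2_inner \<Omega> (f j) (f j) = 1\<close>, so neither factor vanishes; dividing the relation for \<open>j \<noteq> k\<close> by
  \<open>1 + lam j\<close> gives orthogonality without knowing the sign of the eigenvalues.
\<close>

lemma L2_inner_eigendata:
  assumes "neumann_eigendata \<Omega> lam f"
  shows "L2_inner \<Omega> (f j) (f k) \<noteq> 0 \<longleftrightarrow> j = k"
proof -
  have e: "f i \<in> neumann_eigenspace \<Omega> (lam i)" for i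
    using assms by (simp add: neumann_eigendata_def neumann_eigenpair_def)
  have "(1 + lam i) * L2_inner \<Omega> (f i) (f l) = (if i = l then 1 else 0)" for i l
    using H1_inner_eigenspace[OF e[of i] neumann_eigenspaceD(1)[OF e[of l]]] assms
    by (simp add: neumann_eigendata_def)
  from this[of j j] this[of j k] show ?thesis
    by (auto split: if_splits)
qed

theorem theorem6p2:
  fixes \<Omega>1 :: "'a::euclidean_space set" and \<Omega>2 :: "'b::euclidean_space set"
    and lam1 lam2 :: "nat \<Rightarrow> real"
    and f1 :: "nat \<Rightarrow> 'a \<Rightarrow> real" and f2 :: "nat \<Rightarrow> 'b \<Rightarrow> real"
    and u :: "nat \<Rightarrow> nat \<Rightarrow> 'a \<times> 'b \<Rightarrow> real"
  assumes "region \<Omega>1" "cond_B1 \<Omega>1" "cond_B2 \<Omega>1"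
    and "region \<Omega>2" "cond_B1 \<Omega>2" "cond_B2 \<Omega>2"
    and "neumann_eigendata \<Omega>1 lam1 f1"
    and "neumann_eigendata \<Omega>2 lam2 f2"
    and "\<And>j k. u j k = tensor (f1 j) (f2 k)"
  shows "(\<forall>j k. neumann_eigenpair (\<Omega>1 \<times> \<Omega>2) (lam1 j + lam2 k) (u j k)) \<and>
    (\<forall>j k l m. (j, k) \<noteq> (l, m) \<longrightarrow> L2_inner (\<Omega>1 \<times> \<Omega>2) (u j k) (u l m) = 0) \<and>
    (\<forall>j k l m. (j, k) \<noteq> (l, m) \<longrightarrow> H1_inner (\<Omega>1 \<times> \<Omega>2) (u j k) (u l m) = 0)"
proof -
  have op: "open \<Omega>1" "open \<Omega>2"
    using assms(1,4) by (simp_all add: region_def)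
  interpret lebesgue_product \<Omega>1 \<Omega>2
    using op by (rule open_lebesgue_product)
  have e1: "f1 j \<in> neumann_eigenspace \<Omega>1 (lam1 j)" for j
    using assms(7) by (simp add: neumann_eigendata_def neumann_eigenpair_def)
  have e2: "f2 k \<in> neumann_eigenspace \<Omega>2 (lam2 k)" for k
    using assms(8) by (simp add: neumann_eigendata_def neumann_eigenpair_def)
  have e: "u j k \<in> neumann_eigenspace (\<Omega>1 \<times> \<Omega>2) (lam1 j + lam2 k)" for j k
    unfolding assms(9) by (rule tensor_eigenspace[OF op e1 e2])
  have L2: "L2_inner (\<Omega>1 \<times> \<Omega>2) (u j k) (u l m) \<noteq> 0 \<longleftrightarrow> (j, k) = (l, m)" for j k l m
    unfolding assms(9)
    using L2_inner_tensor[OF H1_Lp_2[OF neumann_eigenspaceD(1)[OF e1]] H1_Lp_2[OF neumann_eigenspaceD(1)[OF e1]]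
      H1_Lp_2[OF neumann_eigenspaceD(1)[OF e2]] H1_Lp_2[OF neumann_eigenspaceD(1)[OF e2]], of j k l m]
      L2_inner_eigendata[OF assms(7), of j l] L2_inner_eigendata[OF assms(8), of k m]
    by simp
  have "\<not> (AE z in lebesgue_on (\<Omega>1 \<times> \<Omega>2). u j k z = 0)" for j k
  proof
    assume "AE z in lebesgue_on (\<Omega>1 \<times> \<Omega>2). u j k z = 0"
    then have "AE z in lebesgue_on (\<Omega>1 \<times> \<Omega>2). u j k z * u j k z = 0"
      by eventually_elim simp
    then have "L2_inner (\<Omega>1 \<times> \<Omega>2) (u j k) (u j k) = 0"
      unfolding L2_inner_def by (rule integral_eq_zero_AE)
    with L2 show False by blast
  qed
  moreover have "H1_inner (\<Omega>1 \<times> \<Omega>2) (u j k) (u l m)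
      = (1 + (lam1 j + lam2 k)) * L2_inner (\<Omega>1 \<times> \<Omega>2) (u j k) (u l m)" for j k l m
    by (rule H1_inner_eigenspace[OF e neumann_eigenspaceD(1)[OF e]])
  moreover have "L2_inner (\<Omega>1 \<times> \<Omega>2) (u j k) (u l m) = 0" if "(j, k) \<noteq> (l, m)" for j k l m
    using L2 that by blast
  ultimately show ?thesis
    using e by (simp add: neumann_eigenpair_def)
qed

end
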